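(* Let $n$ and $k$ be positive integers and let $\mu$ be a partition. Then in the ring of symmetric functions $\Lambda_{\mathbb{Q}}$, $$(p_{n}\circ h_{k})\,s_{\mu}=\sum_{\substack{\lambda\vdash |\mu|+nk\\ \mu\subset\lambda}}\det\big(\mathcal{M}(\lambda/\mu)\big)\,s_{\lambda}.$$
   Context: $\Lambda_{\mathbb{Q}}$ is the ring of symmetric functions over $\mathbb{Q}$ in infinitely many variables $x_1,x_2,\dots$; $p_n$, $h_k$, $s_\lambda$ are the power sum, complete homogeneous and Schur symmetric functions. The plethysm $p_n\circ h_k$ is $h_k(x_1^n,x_2^n,\ldots)$. For partitions, $\mu\subset\lambda$ means $\mu_i\le\lambda_i$ for all $i$, and $\ell(\lambda)$ is the number of nonzero parts of $\lambda$. For partitions $\mu\subset\lambda$ (and the fixed $n$), $\mathcal{M}(\lambda/\mu)=(m_{ij})$ is the $\ell(\lambda)\times\ell(\lambda)$ matrix with $$m_{ij}=\begin{cases}1 & \text{if } \lambda_i-i\ge \mu_j-j \text{ and } n\mid(\lambda_i-i-\mu_j+j),\\ 0&\text{otherwise,}\end{cases}\qquad 1\le i,j\le \ell(\lambda),$$ where $\mu$ is padded with zeros at the end if $\ell(\mu)<\ell(\lambda)$. *)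

theory Defs
  imports
    "HOL-Library.Multiset"
    "HOL-Library.FuncSet"
    "HOL-Combinatorics.Permutations"
    "Jordan_Normal_Form.Determinant"
begin

section \<open>The ring of symmetric functions over the rationals\<close>

text \<open>
  A monomial in the variables \<open>x\<^sub>0, x\<^sub>1, \<dots>\<close> is the multiset of the indices of its factors, so that
  multiplication of monomials is addition of multisets and the total degree is \<^const>\<open>size\<close>.
  A symmetric function is given by the coefficients of its monomials: it is a formal power series
  of bounded degree, invariant under all permutations of the variables.
\<close>

definition is_symfun :: "(nat multiset \<Rightarrow> rat) \<Rightarrow> bool" where
  "is_symfun f \<longleftrightarrow> (\<exists>d. \<forall>M. f M \<noteq> 0 \<longrightarrow> size M \<le> d) \<and>
     (\<forall>\<pi> M. bij \<pi> \<longrightarrow> f (image_mset \<pi> M) = f M)"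

lemma is_symfunI:
  assumes "\<And>M. f M \<noteq> 0 \<Longrightarrow> size M \<le> d" "\<And>\<pi> M. bij \<pi> \<Longrightarrow> f (image_mset \<pi> M) = f M"
  shows "is_symfun f"
  using assms unfolding is_symfun_def by blast

lemma is_symfunE:
  assumes "is_symfun f"
  obtains d where "\<And>M. f M \<noteq> 0 \<Longrightarrow> size M \<le> d" "\<And>\<pi> M. bij \<pi> \<Longrightarrow> f (image_mset \<pi> M) = f M"
  using assms unfolding is_symfun_def by blast

typedef symfun = "{f. is_symfun f}"
  morphisms symfun_coeff Abs_symfun
  by (rule exI[of _ "\<lambda>_. 0"]) (simp add: is_symfun_def)

setup_lifting type_definition_symfun

lemma symfun_eqI: "(\<And>M. symfun_coeff f M = symfun_coeff g M) \<Longrightarrow> f = g"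
  by (rule iffD1[OF symfun_coeff_inject], rule ext)

lemma finite_submultisets: "finite {A. A \<subseteq># (M :: 'a multiset)}"
proof (induction M)
  case empty
  then show ?case by simp
next
  case (add x M)
  have "{A. A \<subseteq># add_mset x M} \<subseteq> {A. A \<subseteq># M} \<union> add_mset x ` {A. A \<subseteq># M}"
  proof
    fix A assume A: "A \<in> {A. A \<subseteq># add_mset x M}"
    show "A \<in> {A. A \<subseteq># M} \<union> add_mset x ` {A. A \<subseteq># M}"
    proof (cases "x \<in># A")
      case True
      then obtain B where "A = add_mset x B" by (meson mset_add)
      with A show ?thesis by auto
    next
      case False
      with A have "A \<subseteq># M"
        by (auto simp: subseteq_mset_def count_eq_zero_iff) (metis count_eq_zero_iff le0)
      then show ?thesis by simp
    qed
  qed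
  then show ?case by (rule finite_subset) (use add in simp)
qed

lemma finite_splits: "finite {(A, B). A + B = (M :: 'a multiset)}"
  by (rule finite_subset[of _ "{A. A \<subseteq># M} \<times> {A. A \<subseteq># M}"]) (auto simp: finite_submultisets)

lemma image_mset_inv:
  assumes "bij \<pi>"
  shows "image_mset (inv_into UNIV \<pi>) (image_mset \<pi> M) = M"
    and "image_mset \<pi> (image_mset (inv_into UNIV \<pi>) M) = M"
proof -
  have "inv_into UNIV \<pi> (\<pi> x) = x" "\<pi> (inv_into UNIV \<pi> x) = x" for x
    using assms by (simp_all add: bij_is_inj bij_is_surj surj_f_inv_f)
  then show "image_mset (inv_into UNIV \<pi>) (image_mset \<pi> M) = M"
    "image_mset \<pi> (image_mset (inv_into UNIV \<pi>) M) = M"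
    by (simp_all add: multiset.map_comp o_def)
qed

lemma image_repeat_mset: "image_mset f (repeat_mset n M) = repeat_mset n (image_mset f M)"
  by (induction n) auto

instantiation symfun :: comm_ring_1
begin

lift_definition zero_symfun :: symfun is "\<lambda>_. 0"
  by (simp add: is_symfun_def)

lift_definition one_symfun :: symfun is "\<lambda>M. if M = {#} then 1 else 0"
  by (rule is_symfunI[of _ 0]) (auto split: if_splits)

lift_definition uminus_symfun :: "symfun \<Rightarrow> symfun" is "\<lambda>f M. - f M"
  by (simp add: is_symfun_def)

lift_definition plus_symfun :: "symfun \<Rightarrow> symfun \<Rightarrow> symfun" is "\<lambda>f g M. f M + g M"
proof -
  fix f g :: "nat multiset \<Rightarrow> rat"
  assume "is_symfun f" "is_symfun g"
  then obtain d e where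
    f: "\<And>M. f M \<noteq> 0 \<Longrightarrow> size M \<le> d" "\<And>\<pi> M. bij \<pi> \<Longrightarrow> f (image_mset \<pi> M) = f M" and
    g: "\<And>M. g M \<noteq> 0 \<Longrightarrow> size M \<le> e" "\<And>\<pi> M. bij \<pi> \<Longrightarrow> g (image_mset \<pi> M) = g M"
    by (auto elim!: is_symfunE)
  show "is_symfun (\<lambda>M. f M + g M)"
  proof (rule is_symfunI[of _ "d + e"])
    fix M assume "f M + g M \<noteq> 0"
    then have "f M \<noteq> 0 \<or> g M \<noteq> 0" by auto
    then show "size M \<le> d + e" using f(1)[of M] g(1)[of M] by auto
  qed (simp add: f g)
qed

definition minus_symfun :: "symfun \<Rightarrow> symfun \<Rightarrow> symfun" where
  "minus_symfun f g = f + - g"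

lift_definition times_symfun :: "symfun \<Rightarrow> symfun \<Rightarrow> symfun" is
  "\<lambda>f g M. \<Sum>(A, B) | A + B = M. f A * g B"
proof -
  fix f g :: "nat multiset \<Rightarrow> rat"
  assume "is_symfun f" "is_symfun g"
  then obtain d e where
    f: "\<And>M. f M \<noteq> 0 \<Longrightarrow> size M \<le> d" "\<And>\<pi> M. bij \<pi> \<Longrightarrow> f (image_mset \<pi> M) = f M" and
    g: "\<And>M. g M \<noteq> 0 \<Longrightarrow> size M \<le> e" "\<And>\<pi> M. bij \<pi> \<Longrightarrow> g (image_mset \<pi> M) = g M"
    by (auto elim!: is_symfunE)
  show "is_symfun (\<lambda>M. \<Sum>(A, B) | A + B = M. f A * g B)"
  proof (rule is_symfunI[of _ "d + e"])
    fix M assume "(\<Sum>(A, B) | A + B = M. f A * g B) \<noteq> 0"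
    then obtain A B where "A + B = M" "f A * g B \<noteq> 0"
      by (auto elim!: sum.not_neutral_contains_not_neutral)
    then show "size M \<le> d + e" using f(1)[of A] g(1)[of B] by force
  next
    fix \<pi> :: "nat \<Rightarrow> nat" and M assume p: "bij \<pi>"
    show "(\<Sum>(A, B) | A + B = image_mset \<pi> M. f A * g B) = (\<Sum>(A, B) | A + B = M. f A * g B)"
      by (rule sum.reindex_bij_witness[of _ "map_prod (image_mset \<pi>) (image_mset \<pi>)"
            "map_prod (image_mset (inv_into UNIV \<pi>)) (image_mset (inv_into UNIV \<pi>))"])
         (use f(2) g(2) p bij_imp_bij_inv[OF p] in
           \<open>auto simp: image_mset_inv simp flip: image_mset_union\<close>)
  qed
qed

instance
proof
  fix f g h :: symfun
  show "f + g + h = f + (g + h)" "f + g = g + f" "0 + f = f" "- f + f = 0"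
    by (transfer; simp add: fun_eq_iff add_ac)+
  show "f - g = f + - g" by (rule minus_symfun_def)
  show "(0::symfun) \<noteq> 1" by transfer (auto simp: fun_eq_iff)
  show comm: "f * g = g * f" for f g :: symfun
    by (rule symfun_eqI, transfer, rule sum.reindex_bij_witness[of _ prod.swap prod.swap])
       (auto simp: ac_simps)
  show "(f + g) * h = f * h + g * h"
    by (rule symfun_eqI, transfer)
       (simp add: sum.distrib[symmetric] case_prod_unfold distrib_right)
  show "1 * f = f"
  proof (rule symfun_eqI, transfer)
    fix f :: "nat multiset \<Rightarrow> rat" and M
    have "(\<Sum>(A, B) | A + B = M. (if A = {#} then 1 else 0) * f B)
      = (\<Sum>(A, B) \<in> {({#} :: nat multiset, M)}. (if A = {#} then 1 else 0) * f B)"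
      by (rule sum.mono_neutral_right[OF finite_splits]) (auto split: if_splits)
    then show "(\<Sum>(A, B) | A + B = M. (if A = {#} then 1 else 0) * f B) = f M" by simp
  qed
  show "f * g * h = f * (g * h)"
  proof (rule symfun_eqI, transfer)
    fix f g h :: "nat multiset \<Rightarrow> rat" and M
    have "(\<Sum>(A, B) | A + B = M. (\<Sum>(C, D) | C + D = A. f C * g D) * h B)
      = (\<Sum>(p, q) \<in> (SIGMA p:{(A, B). A + B = M}. {(C, D). C + D = fst p}).
            f (fst q) * g (snd q) * h (snd p))"
      by (subst sum.Sigma[symmetric])
         (auto simp: finite_splits[unfolded case_prod_unfold] sum_distrib_right case_prod_unfold)
    also have "\<dots> = (\<Sum>(p, q) \<in> (SIGMA p:{(A, B). A + B = M}. {(C, D). C + D = snd p}).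
            f (fst p) * (g (fst q) * h (snd q)))"
      by (rule sum.reindex_bij_witness[of _
            "\<lambda>((A, B), (C, D)). ((A + C, D), (A, C))" "\<lambda>((A, B), (C, D)). ((C, D + B), (D, B))"])
         (auto simp: ac_simps)
    also have "\<dots> = (\<Sum>(A, B) | A + B = M. f A * (\<Sum>(C, D) | C + D = B. g C * h D))"
      by (subst sum.Sigma[symmetric])
         (auto simp: finite_splits[unfolded case_prod_unfold] sum_distrib_left case_prod_unfold)
    finally show "(\<Sum>(A, B) | A + B = M. (\<Sum>(C, D) | C + D = A. f C * g D) * h B)
      = (\<Sum>(A, B) | A + B = M. f A * (\<Sum>(C, D) | C + D = B. g C * h D))" .
  qed
qed

end

lift_definition complete_hom :: "nat \<Rightarrow> symfun" is "\<lambda>k M. if size M = k then 1 else 0"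
  subgoal for k by (rule is_symfunI[of _ k]) (auto split: if_splits)
  done

text \<open>
  The plethysm \<open>p\<^sub>n \<circ> f = f(x\<^sub>0\<^sup>n, x\<^sub>1\<^sup>n, \<dots>)\<close>: the monomial \<open>N\<close> of \<open>f\<close> becomes \<^term>\<open>repeat_mset n N\<close>.
  For \<open>n > 0\<close> the sum has at most one term; for \<open>n = 0\<close> the substitution does not make sense, and
  the value here is \<open>0\<close>.
\<close>

lift_definition power_sum_plethysm :: "nat \<Rightarrow> symfun \<Rightarrow> symfun" is
  "\<lambda>n f M. \<Sum>N | repeat_mset n N = M. f N"
proof -
  fix n :: nat and f :: "nat multiset \<Rightarrow> rat"
  assume "is_symfun f"
  then obtain d where
    f: "\<And>M. f M \<noteq> 0 \<Longrightarrow> size M \<le> d" "\<And>\<pi> M. bij \<pi> \<Longrightarrow> f (image_mset \<pi> M) = f M"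
    by (auto elim!: is_symfunE)
  show "is_symfun (\<lambda>M. \<Sum>N | repeat_mset n N = M. f N)"
  proof (rule is_symfunI[of _ "n * d"])
    fix M assume "(\<Sum>N | repeat_mset n N = M. f N) \<noteq> 0"
    then obtain N where "repeat_mset n N = M" "f N \<noteq> 0"
      by (auto elim!: sum.not_neutral_contains_not_neutral)
    then show "size M \<le> n * d" using f(1)[of N] by auto
  next
    fix \<pi> :: "nat \<Rightarrow> nat" and M assume p: "bij \<pi>"
    show "(\<Sum>N | repeat_mset n N = image_mset \<pi> M. f N) = (\<Sum>N | repeat_mset n N = M. f N)"
      by (rule sum.reindex_bij_witness[of _ "image_mset \<pi>" "image_mset (inv_into UNIV \<pi>)"])
         (use f(2) p bij_imp_bij_inv[OF p] in
           \<open>auto simp: image_mset_inv simp flip: image_repeat_mset\<close>)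
  qed
qed


section \<open>Partitions and Schur functions\<close>

definition is_partition :: "nat list \<Rightarrow> bool" where
  "is_partition lam \<longleftrightarrow> sorted_wrt (\<ge>) lam \<and> 0 \<notin> set lam"

text \<open>Rows are indexed from \<open>0\<close>, and a partition is padded with zeros.\<close>

definition part :: "nat list \<Rightarrow> nat \<Rightarrow> nat" where
  "part lam i = (if i < length lam then lam ! i else 0)"

definition part_subset :: "nat list \<Rightarrow> nat list \<Rightarrow> bool" where
  "part_subset mu lam \<longleftrightarrow> (\<forall>i. part mu i \<le> part lam i)"

definition young_diagram :: "nat list \<Rightarrow> (nat \<times> nat) set" where
  "young_diagram lam = {(i, j). j < part lam i}"

text \<open>Semistandard Young tableaux, with entries in the set of variable indices (so \<open>0\<close> is allowed).\<close>

definition ssyt :: "nat list \<Rightarrow> (nat \<times> nat \<Rightarrow> nat) set" where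
  "ssyt lam = {T \<in> young_diagram lam \<rightarrow>\<^sub>E UNIV.
     (\<forall>i j. (i, Suc j) \<in> young_diagram lam \<longrightarrow> T (i, j) \<le> T (i, Suc j)) \<and>
     (\<forall>i j. (Suc i, j) \<in> young_diagram lam \<longrightarrow> T (i, j) < T (Suc i, j))}"

definition tableau_content :: "nat list \<Rightarrow> (nat \<times> nat \<Rightarrow> nat) \<Rightarrow> nat multiset" where
  "tableau_content lam T = image_mset T (mset_set (young_diagram lam))"

lemma young_diagram_Sigma: "young_diagram lam = (SIGMA i:{..<length lam}. {..<part lam i})"
  by (auto simp: young_diagram_def part_def split: if_splits)

lemma finite_young_diagram: "finite (young_diagram lam)"
  by (simp add: young_diagram_Sigma)

lemma part_antimono:
  assumes "is_partition lam" "i \<le> j"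
  shows "part lam j \<le> part lam i"
proof (cases "i = j")
  case False
  then show ?thesis
    using assms by (auto simp: is_partition_def part_def sorted_wrt_iff_nth_less)
qed simp

lemma finite_ssyt_content: "finite {T \<in> ssyt lam. tableau_content lam T = M}"
proof (rule finite_subset)
  show "{T \<in> ssyt lam. tableau_content lam T = M} \<subseteq> young_diagram lam \<rightarrow>\<^sub>E set_mset M"
    by (auto simp: ssyt_def tableau_content_def PiE_iff extensional_def finite_young_diagram)
  show "finite (young_diagram lam \<rightarrow>\<^sub>E set_mset M)"
    by (simp add: finite_PiE finite_young_diagram)
qed

text \<open>
  The generating function of the semistandard tableaux is symmetric. For an adjacent transposition
  this is the Bender--Knuth involution, phrased in terms of the number of entries smaller
  than \<open>s\<close> in row \<open>i\<close>.
\<close>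

definition row_count :: "nat list \<Rightarrow> (nat \<times> nat \<Rightarrow> nat) \<Rightarrow> nat \<Rightarrow> nat \<Rightarrow> nat" where
  "row_count lam T s i = card {j. j < part lam i \<and> T (i, j) < s}"

lemma downset_card:
  fixes P :: "nat \<Rightarrow> bool"
  assumes "\<And>i j. i \<le> j \<Longrightarrow> j < m \<Longrightarrow> P j \<Longrightarrow> P i" "j < m"
  shows "P j \<longleftrightarrow> j < card {j. j < m \<and> P j}"
proof
  assume "P j"
  then have "{..j} \<subseteq> {j. j < m \<and> P j}" using assms by auto
  then have "card {..j} \<le> card {j. j < m \<and> P j}" by (intro card_mono) auto
  then show "j < card {j. j < m \<and> P j}" by simp
next
  assume *: "j < card {j. j < m \<and> P j}"
  show "P j"
  proof (rule ccontr)
    assume "\<not> P j"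
    then have "{j. j < m \<and> P j} \<subseteq> {..<j}" using assms by (metis (mono_tags, lifting) lessThan_iff linorder_not_le mem_Collect_eq subsetI)
    then have "card {j. j < m \<and> P j} \<le> j" by (metis card_lessThan card_mono finite_lessThan)
    with * show False by simp
  qed
qed

lemma ssyt_row_mono:
  assumes "T \<in> ssyt lam" "j \<le> j'" "j' < part lam i"
  shows "T (i, j) \<le> T (i, j')"
  using assms(2,3)
proof (induction rule: dec_induct)
  case (step n)
  then have "T (i, n) \<le> T (i, Suc n)" using assms(1) by (auto simp: ssyt_def young_diagram_def)
  with step show ?case by simp
qed simp

lemma row_count_iff:
  assumes "T \<in> ssyt lam" "j < part lam i"
  shows "T (i, j) < s \<longleftrightarrow> j < row_count lam T s i"
  unfolding row_count_def
  by (rule downset_card[OF _ assms(2)]) (use ssyt_row_mono[OF assms(1)] le_less_trans in blast)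

lemma row_count_le: "row_count lam T s i \<le> part lam i"
proof -
  have "card {j. j < part lam i \<and> T (i, j) < s} \<le> card {..<part lam i}" by (intro card_mono) auto
  then show ?thesis by (simp add: row_count_def)
qed

lemma row_count_mono: "s \<le> t \<Longrightarrow> row_count lam T s i \<le> row_count lam T t i"
  unfolding row_count_def by (intro card_mono) auto

lemma row_count_col:
  assumes "is_partition lam" "T \<in> ssyt lam"
  shows "row_count lam T (Suc s) (Suc i) \<le> row_count lam T s i"
  unfolding row_count_def
proof (intro card_mono subsetI CollectI)
  fix j assume "j \<in> {j. j < part lam (Suc i) \<and> T (Suc i, j) < Suc s}"
  then show "j < part lam i \<and> T (i, j) < s"
    using part_antimono[OF assms(1), of i "Suc i"] assms(2)
    by (force simp: ssyt_def young_diagram_def)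
qed simp

lemma row_count_length: "length lam \<le> i \<Longrightarrow> row_count lam T s i = 0"
  by (simp add: row_count_def part_def)

lemma count_content:
  "count (tableau_content lam T) s = (\<Sum>i<length lam. row_count lam T (Suc s) i - row_count lam T s i)"
proof -
  have "count (tableau_content lam T) s = card {p \<in> young_diagram lam. T p = s}"
    by (simp add: tableau_content_def count_image_mset' finite_young_diagram) 
       (metis (mono_tags, lifting) Collect_cong)
  also have "{p \<in> young_diagram lam. T p = s}
    = (SIGMA i:{..<length lam}. {j. j < part lam i \<and> T (i, j) = s})"
    by (auto simp: young_diagram_Sigma)
  also have "card \<dots> = (\<Sum>i<length lam. card {j. j < part lam i \<and> T (i, j) = s})"
    by simp
  also have "\<dots> = (\<Sum>i<length lam. row_count lam T (Suc s) i - row_count lam T s i)"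
  proof (rule sum.cong[OF refl])
    fix i
    have "{j. j < part lam i \<and> T (i, j) = s}
      = {j. j < part lam i \<and> T (i, j) < Suc s} - {j. j < part lam i \<and> T (i, j) < s}" by auto
    then show "card {j. j < part lam i \<and> T (i, j) = s} = row_count lam T (Suc s) i - row_count lam T s i"
      unfolding row_count_def by (simp add: card_Diff_subset Collect_mono less_SucI)
  qed
  finally show ?thesis .
qed

definition bk_middle :: "nat list \<Rightarrow> nat \<Rightarrow> (nat \<times> nat \<Rightarrow> nat) \<Rightarrow> nat \<Rightarrow> nat" where
  "bk_middle lam r T i =
     (if i = 0 then row_count lam T (r + 2) i
      else min (row_count lam T (r + 2) i) (row_count lam T r (i - 1)))
     + max (row_count lam T (r + 2) (Suc i)) (row_count lam T r i) - row_count lam T (r + 1) i"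

definition bender_knuth :: "nat list \<Rightarrow> nat \<Rightarrow> (nat \<times> nat \<Rightarrow> nat) \<Rightarrow> (nat \<times> nat \<Rightarrow> nat)" where
  "bender_knuth lam r T = (\<lambda>(i, j).
     if row_count lam T r i \<le> j \<and> j < row_count lam T (r + 2) i
     then if j < bk_middle lam r T i then r else r + 1
     else T (i, j))"

context
  fixes lam :: "nat list" and T :: "nat \<times> nat \<Rightarrow> nat" and r :: nat
  assumes lam: "is_partition lam" and T: "T \<in> ssyt lam"
begin

lemma bk_middle_add:
  "bk_middle lam r T i + row_count lam T (r + 1) i =
     (if i = 0 then row_count lam T (r + 2) i
      else min (row_count lam T (r + 2) i) (row_count lam T r (i - 1)))
     + max (row_count lam T (r + 2) (Suc i)) (row_count lam T r i)"
proof -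
  have "row_count lam T (r + 1) i \<le> (if i = 0 then row_count lam T (r + 2) i
      else min (row_count lam T (r + 2) i) (row_count lam T r (i - 1)))"
    using row_count_mono[of "r + 1" "r + 2" lam T i] row_count_col[OF lam T, of r "i - 1"]
    by (cases i) simp_all
  then show ?thesis unfolding bk_middle_def by linarith
qed

lemma bk_middle_bounds:
  "row_count lam T r i \<le> bk_middle lam r T i"
  "bk_middle lam r T i \<le> row_count lam T (r + 2) i"
  "row_count lam T (r + 2) (Suc i) \<le> bk_middle lam r T i"
  "bk_middle lam r T (Suc i) \<le> row_count lam T r i"
proof -
  define m where "m i = (if i = 0 then row_count lam T (r + 2) i
      else min (row_count lam T (r + 2) i) (row_count lam T r (i - 1)))" for i
  define M where "M i = max (row_count lam T (r + 2) (Suc i)) (row_count lam T r i)" for i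
  have eq: "bk_middle lam r T i + row_count lam T (r + 1) i = m i + M i" for i
    unfolding m_def M_def by (rule bk_middle_add)
  have lo: "row_count lam T (r + 1) i \<le> m i" for i
    using row_count_mono[of "r + 1" "r + 2" lam T i] row_count_col[OF lam T, of r "i - 1"]
    by (cases i) (simp_all add: m_def)
  have hi: "M i \<le> row_count lam T (r + 1) i" for i
    using row_count_mono[of r "r + 1" lam T i] row_count_col[OF lam T, of "r + 1" i]
    by (simp add: M_def)
  have "m i \<le> row_count lam T (r + 2) i" "m (Suc i) \<le> row_count lam T r i"
    "row_count lam T r i \<le> M i" "row_count lam T (r + 2) (Suc i) \<le> M i"
    by (simp_all add: m_def M_def)
  then show "row_count lam T r i \<le> bk_middle lam r T i"
    "bk_middle lam r T i \<le> row_count lam T (r + 2) i"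
    "row_count lam T (r + 2) (Suc i) \<le> bk_middle lam r T i"
    "bk_middle lam r T (Suc i) \<le> row_count lam T r i"
    using eq[of i] eq[of "Suc i"] lo[of i] lo[of "Suc i"] hi[of i] hi[of "Suc i"] by linarith+
qed

lemma bk_row_iff:
  assumes "j < part lam i"
  shows "bender_knuth lam r T (i, j) < s
    \<longleftrightarrow> j < (if s = r + 1 then bk_middle lam r T i else row_count lam T s i)"
proof -
  note b = bk_middle_bounds[of i]
  note c = row_count_iff[OF T assms]
  consider "s \<le> r" | "s = r + 1" | "s \<ge> r + 2" by linarith
  then show ?thesis
  proof cases
    case 1
    then show ?thesis using b c[of s] row_count_mono[OF 1, of lam T i]
      by (auto simp: bender_knuth_def)
  next
    case 2
    then show ?thesis using b c[of r] c[of "r + 2"] by (auto simp: bender_knuth_def)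
  next
    case 3
    then show ?thesis using b c[of s] row_count_mono[OF 3, of lam T i]
      by (auto simp: bender_knuth_def)
  qed
qed

lemma bk_row_count:
  "row_count lam (bender_knuth lam r T) s i
    = (if s = r + 1 then bk_middle lam r T i else row_count lam T s i)" (is "_ = ?c")
proof -
  have "?c \<le> part lam i"
    using bk_middle_bounds(2)[of i] row_count_le[of lam T "r + 2" i] row_count_le[of lam T s i] by auto
  then have "{j. j < part lam i \<and> bender_knuth lam r T (i, j) < s} = {..<?c}"
    using bk_row_iff[of _ i s] by auto
  then show ?thesis by (simp add: row_count_def)
qed

lemma bk_ssyt: "bender_knuth lam r T \<in> ssyt lam"
proof -
  let ?B = "bender_knuth lam r T"
  have "?B \<in> young_diagram lam \<rightarrow>\<^sub>E UNIV"
  proof (rule PiE_I)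
    fix p assume p: "p \<notin> young_diagram lam"
    obtain i j where ij: "p = (i, j)" by (cases p)
    have "T \<in> young_diagram lam \<rightarrow>\<^sub>E UNIV" using T unfolding ssyt_def by blast
    then have "T p = undefined" using p by (rule PiE_arb)
    moreover have "\<not> j < row_count lam T (r + 2) i"
      using row_count_le[of lam T "r + 2" i] p ij by (simp add: young_diagram_def)
    ultimately show "?B p = undefined" by (simp add: bender_knuth_def ij)
  qed simp
  moreover have "?B (i, j) \<le> ?B (i, Suc j)" if "Suc j < part lam i" for i j
  proof -
    let ?t = "?B (i, Suc j)"
    have "Suc j < row_count lam ?B (Suc ?t) i"
      using bk_row_iff[OF that, of "Suc ?t"] unfolding bk_row_count by simp
    then have "?B (i, j) < Suc ?t"
      using bk_row_iff[of j i "Suc ?t"] that unfolding bk_row_count by simp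
    then show ?thesis by simp
  qed
  moreover have "?B (i, j) < ?B (Suc i, j)" if j: "j < part lam (Suc i)" for i j
  proof -
    have j': "j < part lam i" using part_antimono[OF lam, of i "Suc i"] j by simp
    let ?t = "?B (Suc i, j)"
    have "j < row_count lam ?B (Suc ?t) (Suc i)"
      using bk_row_iff[OF j, of "Suc ?t"] unfolding bk_row_count by simp
    also have "\<dots> \<le> row_count lam ?B ?t i"
      unfolding bk_row_count
      using row_count_col[OF lam T, of ?t i] bk_middle_bounds(3,4)[of i]
      by (cases "?t = r"; cases "?t = r + 1") simp_all
    finally show ?thesis using bk_row_iff[OF j', of ?t] unfolding bk_row_count by simp
  qed
  ultimately show ?thesis unfolding ssyt_def young_diagram_def by blast
qed

lemma bk_sum:
  "(\<Sum>i<length lam. bk_middle lam r T i + row_count lam T (r + 1) i)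
    = (\<Sum>i<length lam. row_count lam T r i + row_count lam T (r + 2) i)"
proof -
  let ?a = "row_count lam T r" and ?b = "row_count lam T (r + 1)" and ?c = "row_count lam T (r + 2)"
  let ?m = "\<lambda>i. if i = 0 then ?c i else min (?c i) (?a (i - 1))"
  let ?M = "\<lambda>i. max (?c (Suc i)) (?a i)"
  have 1: "bk_middle lam r T i + ?b i = ?m i + ?M i" for i
    by (rule bk_middle_add)
  have 2: "?M i + ?m (Suc i) = ?a i + ?c (Suc i)" for i by simp
  have "(\<Sum>i<m. ?m i + ?M i) + ?m m = (\<Sum>i<m. ?a i + ?c i) + ?c m" for m
  proof (induction m)
    case (Suc m)
    then show ?case using 2[of m] by (simp only: sum.lessThan_Suc)
  qed simp
  from this[of "length lam"] show ?thesis
    unfolding 1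
    by (cases "length lam = 0") (simp_all only: row_count_length order.refl min_0L add_0_right if_False lessThan_0 sum.empty)
qed

lemma bk_content:
  "tableau_content lam (bender_knuth lam r T) = image_mset (Transposition.transpose r (r + 1)) (tableau_content lam T)"
proof (rule multiset_eqI)
  fix s
  let ?t = "Transposition.transpose r (r + 1)"
  have "?t y = s \<longleftrightarrow> y = ?t s" for y by (auto simp: transpose_def)
  then have "?t -` {s} = {?t s}" by auto
  then have R: "count (image_mset ?t (tableau_content lam T)) s = count (tableau_content lam T) (?t s)"
    by (cases "?t s \<in># tableau_content lam T") (simp_all add: count_image_mset not_in_iff)
  have m: "row_count lam T r i \<le> row_count lam T (r + 1) i"
    "row_count lam T (r + 1) i \<le> row_count lam T (r + 2) i"
    "row_count lam T r i \<le> bk_middle lam r T i" "bk_middle lam r T i \<le> row_count lam T (r + 2) i" for i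
    using bk_middle_bounds[of i] by (auto intro: row_count_mono)
  have s: "(\<Sum>i<length lam. row_count lam T r i) \<le> (\<Sum>i<length lam. row_count lam T (r + 1) i)"
    "(\<Sum>i<length lam. row_count lam T (r + 1) i) \<le> (\<Sum>i<length lam. row_count lam T (r + 2) i)"
    "(\<Sum>i<length lam. row_count lam T r i) \<le> (\<Sum>i<length lam. bk_middle lam r T i)"
    "(\<Sum>i<length lam. bk_middle lam r T i) \<le> (\<Sum>i<length lam. row_count lam T (r + 2) i)"
    using m by (auto intro!: sum_mono)
  consider "s = r" | "s = r + 1" | "s \<noteq> r" "s \<noteq> r + 1" by blast
  then show "count (tableau_content lam (bender_knuth lam r T)) s = count (image_mset ?t (tableau_content lam T)) s"
  proof cases
    case 1
    then show ?thesis unfolding R using m s bk_sum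
      by (simp add: count_content bk_row_count sum_subtractf_nat sum.distrib)
  next
    case 2
    then show ?thesis unfolding R using m s bk_sum
      by (simp add: count_content bk_row_count sum_subtractf_nat sum.distrib)
  next
    case 3
    then show ?thesis unfolding R by (auto simp: count_content bk_row_count transpose_def)
  qed
qed

end

lemma bk_inj:
  assumes "is_partition lam"
  shows "inj_on (bender_knuth lam r) (ssyt lam)"
proof (rule inj_onI)
  fix T U assume TU: "T \<in> ssyt lam" "U \<in> ssyt lam"
    and eq: "bender_knuth lam r T = bender_knuth lam r U"
  note bT = bk_row_count[OF assms TU(1), of r] and bU = bk_row_count[OF assms TU(2), of r]
  have e: "row_count lam T s i = row_count lam U s i" if "s \<noteq> r + 1" for s i
    using bT[of s i] bU[of s i] eq that by simp
  have "bk_middle lam r T i = bk_middle lam r U i" for i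
    using bT[of "r + 1" i] bU[of "r + 1" i] eq by simp
  then have "row_count lam T (r + 1) i = row_count lam U (r + 1) i" for i
    using bk_middle_add[OF assms TU(1), of r i] bk_middle_add[OF assms TU(2), of r i]
      e[of r] e[of "r + 2"] by (simp cong: if_cong)
  with e have "row_count lam T s i = row_count lam U s i" for s i by metis
  then have "T (i, j) < s \<longleftrightarrow> U (i, j) < s" if "j < part lam i" for i j s
    using row_count_iff TU that by metis
  then have "T (i, j) = U (i, j)" if "j < part lam i" for i j
    using that by (metis linorder_neqE_nat less_irrefl)
  then show "T = U"
    using TU by (intro PiE_ext[of T "young_diagram lam" "\<lambda>_. UNIV" U])
      (auto simp: ssyt_def young_diagram_def)
qed

definition ssyt_number :: "nat list \<Rightarrow> nat multiset \<Rightarrow> nat" where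
  "ssyt_number lam M = card {T \<in> ssyt lam. tableau_content lam T = M}"

lemma ssyt_number_adjacent:
  assumes "is_partition lam"
  shows "ssyt_number lam (image_mset (Transposition.transpose r (r + 1)) M) = ssyt_number lam M"
proof -
  let ?t = "image_mset (Transposition.transpose r (r + 1))"
  have le: "ssyt_number lam M \<le> ssyt_number lam (?t M)" for M
    unfolding ssyt_number_def
    by (rule card_inj_on_le[of "bender_knuth lam r", OF _ _ finite_ssyt_content])
       (auto simp: bk_ssyt[OF assms] bk_content[OF assms] intro: inj_on_subset[OF bk_inj[OF assms]])
  have "?t (?t M) = M" by (simp add: multiset.map_comp)
  with le[of M] le[of "?t M"] show ?thesis by simp
qed

lemma ssyt_number_transpose:
  assumes "is_partition lam"
  shows "ssyt_number lam (image_mset (Transposition.transpose a b) M) = ssyt_number lam M"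
proof -
  have *: "ssyt_number lam (image_mset (Transposition.transpose a (a + d)) M) = ssyt_number lam M" for a d M
  proof (induction d arbitrary: M)
    case 0
    then show ?case by simp
  next
    case (Suc d)
    let ?s = "Transposition.transpose (a + d) (a + d + 1)" and ?u = "Transposition.transpose a (a + d)"
    show ?case
    proof (cases "d = 0")
      case True
      then show ?thesis using ssyt_number_adjacent[OF assms, of a M] by simp
    next
      case False
      then have "Transposition.transpose a (a + Suc d) = ?s \<circ> (?u \<circ> ?s)"
        by (auto simp: fun_eq_iff transpose_def)
      then have "image_mset (Transposition.transpose a (a + Suc d)) M
          = image_mset ?s (image_mset ?u (image_mset ?s M))"
        by (simp add: multiset.map_comp)
      then show ?thesis using Suc.IH ssyt_number_adjacent[OF assms, of "a + d"] by simp
    qed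
  qed
  show ?thesis
  proof (cases "a \<le> b")
    case True
    then show ?thesis using *[of a "b - a"] by simp
  next
    case False
    then show ?thesis using *[of b "a - b"] by (simp add: transpose_commute)
  qed
qed

lemma ssyt_number_bij:
  assumes "is_partition lam" "bij \<pi>"
  shows "ssyt_number lam (image_mset \<pi> M) = ssyt_number lam M"
proof -
  let ?A = "set_mset M"
  let ?S = "?A \<union> \<pi> ` ?A"
  have inj: "inj_on \<pi> ?A" using assms(2) by (meson bij_is_inj inj_on_subset subset_UNIV)
  have "card (?S - ?A) = card (?S - \<pi> ` ?A)"
    by (simp add: card_Diff_subset card_image[OF inj])
  then obtain g where g: "bij_betw g (?S - ?A) (?S - \<pi> ` ?A)"
    by (metis finite_Diff finite_Un finite_imageI finite_same_card_bij finite_set_mset)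
  define \<sigma> where "\<sigma> x = (if x \<in> ?A then \<pi> x else if x \<in> ?S then g x else x)" for x
  have "bij_betw \<sigma> ?A (\<pi> ` ?A)"
    using inj by (auto simp: bij_betw_def \<sigma>_def inj_on_def)
  moreover have "bij_betw \<sigma> (?S - ?A) (?S - \<pi> ` ?A)"
    using g by (rule bij_betw_cong[THEN iffD1, rotated]) (auto simp: \<sigma>_def)
  ultimately have "bij_betw \<sigma> (?A \<union> (?S - ?A)) (\<pi> ` ?A \<union> (?S - \<pi> ` ?A))"
    by (rule bij_betw_combine) auto
  moreover have "?A \<union> (?S - ?A) = ?S" "\<pi> ` ?A \<union> (?S - \<pi> ` ?A) = ?S" by auto
  ultimately have "\<sigma> permutes ?S"
    by (intro bij_imp_permutes) (auto simp: \<sigma>_def)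
  moreover have "finite ?S" by simp
  ultimately have "ssyt_number lam (image_mset \<sigma> M) = ssyt_number lam M"
  proof (induction rule: permutes_induct)
    case id
    then show ?case by simp
  next
    case (swap a b p)
    then show ?case
      using ssyt_number_transpose[OF assms(1), of a b "image_mset p M"] by (simp add: multiset.map_comp o_def)
  qed
  moreover have "image_mset \<sigma> M = image_mset \<pi> M"
    by (rule image_mset_cong) (simp add: \<sigma>_def)
  ultimately show ?thesis by simp
qed

text \<open>
  The Schur function \<open>s\<^sub>\<lambda> = \<Sum>\<^sub>T x\<^sup>T\<close>, summed over the semistandard tableaux of shape \<open>\<lambda>\<close>; by convention
  it is \<open>0\<close> for a list that is not a partition.
\<close>

lift_definition schur :: "nat list \<Rightarrow> symfun" is
  "\<lambda>lam M. if is_partition lam then of_nat (card {T \<in> ssyt lam. tableau_content lam T = M}) else 0"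
  subgoal for lam
  proof (rule is_symfunI[of _ "card (young_diagram lam)"])
    fix M
    assume "(if is_partition lam then of_nat (card {T \<in> ssyt lam. tableau_content lam T = M}) else 0 :: rat) \<noteq> 0"
    then have "{T \<in> ssyt lam. tableau_content lam T = M} \<noteq> {}"
      by (metis (no_types, lifting) card.empty of_nat_0)
    then show "size M \<le> card (young_diagram lam)" by (auto simp: tableau_content_def)
  qed (use ssyt_number_bij in \<open>auto simp: ssyt_number_def\<close>)
  done


section \<open>The matrix of a skew shape\<close>

text \<open>Rows and columns are indexed from \<open>0\<close>, which does not affect the differences \<open>\<lambda>\<^sub>i - i - (\<mu>\<^sub>j - j)\<close>.\<close>

definition skew_matrix :: "nat \<Rightarrow> nat list \<Rightarrow> nat list \<Rightarrow> int mat" where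
  "skew_matrix n lam mu = mat (length lam) (length lam) (\<lambda>(i, j).
     if int (part lam i) - int i \<ge> int (part mu j) - int j \<and>
        int n dvd int (part lam i) - int i - int (part mu j) + int j
     then 1 else 0)"

lemma finite_partitions: "finite {lam. is_partition lam \<and> sum_list lam = N}"
proof (rule finite_subset)
  show "{lam. is_partition lam \<and> sum_list lam = N} \<subseteq> {xs. set xs \<subseteq> {..N} \<and> length xs \<le> N}"
  proof safe
    fix lam x assume lam: "is_partition lam"
    { fix xs :: "nat list" assume "0 \<notin> set xs"
      then have "length xs \<le> sum_list xs" by (induction xs) auto }
    with lam show "length lam \<le> sum_list lam" by (simp add: is_partition_def)
    assume "x \<in> set lam"
    then show "x \<le> sum_list lam" by (simp add: member_le_sum_list)
  qed
  show "finite {xs. set xs \<subseteq> {..N} \<and> length xs \<le> N}" by (rule finite_lists_length_le) simp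
qed

end

theory Submission
  imports Defs "HOL-Computational_Algebra.Formal_Power_Series"
begin

text \<open>
  The entries of \<open>M(\<lambda>/\<mu>)\<close> are the coefficients of \<open>1 / (1 - t\<^sup>n)\<close>, so that \<open>det M(\<lambda>/\<mu>)\<close> is, by
  Jacobi--Trudi, the skew Schur function \<open>s\<^bsub>\<lambda>/\<mu>\<^esub>\<close> at the \<open>n\<close>-th roots of unity, and the theorem is
  an instance of the skew Cauchy identity. This is proved one variable \<open>x\<close> at a time: the operator
  \<open>\<mu> \<mapsto> \<Sum>\<^sub>\<lambda> det M(\<lambda>/\<mu>) \<lambda>\<close> commutes with the removal of horizontal strips, weighted by
  \<open>x\<close> to the number of removed boxes, up to the factor \<open>1 / (1 - x\<^sup>n)\<close>. In this commutation relation
  both sides are determinants by multilinearity, and they are connected by row and column operations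
  on a single matrix of power series in \<open>x\<close>. Removing from a semistandard tableau its
  largest entries, which form a horizontal strip, then gives the theorem by induction on the number
  of variables; the factors \<open>1 / (1 - x\<^sub>i\<^sup>n)\<close> multiply up to \<open>\<Sum>\<^sub>k p\<^sub>n \<circ> h\<^sub>k\<close>.
\<close>

section \<open>Determinants\<close>

text \<open>Block triangularity. It strips padding rows one by one and removes the last row in the
  exchange argument.\<close>

lemma det_last_row:
  fixes f :: "nat \<Rightarrow> nat \<Rightarrow> 'a :: idom"
  assumes "\<And>j. j < L \<Longrightarrow> f L j = 0"
  shows "det (mat (Suc L) (Suc L) (\<lambda>(i, j). f i j)) = f L L * det (mat L L (\<lambda>(i, j). f i j))"
proof -
  have "mat (Suc L) (Suc L) (\<lambda>(i, j). f i j)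
      = four_block_mat (mat L L (\<lambda>(i, j). f i j)) (mat L 1 (\<lambda>(i, _). f i L)) (0\<^sub>m 1 L) (mat 1 1 (\<lambda>_. f L L))"
    by (rule eq_matI) (use assms in \<open>auto simp: four_block_mat_def Let_def less_Suc_eq\<close>)
  also have "det \<dots> = det (mat L L (\<lambda>(i, j). f i j)) * det (mat 1 1 (\<lambda>_. f L L))"
    by (rule det_four_block_mat_lower_left_zero) auto
  finally show ?thesis by (simp add: det_single)
qed

section \<open>Leibniz expansion and multilinearity in the rows\<close>

lemma det_mat_permutes:
  "det (mat N N (\<lambda>(i, j). f i j)) = (\<Sum>p | p permutes {..<N}. signof p * (\<Prod>i<N. f i (p i)))"
proof -
  have "p i < N" if "p permutes {0..<N}" "i < N" for p i
    using permutes_in_image[OF that(1), of i] that(2) by simp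
  then show ?thesis
    unfolding det_def by (auto simp: atLeast0LessThan[symmetric] intro!: sum.cong prod.cong)
qed

text \<open>Multilinearity: a choice function \<open>g\<close> picks one summand per row. The index
  set depends on the row alone, so that a choice can later be read as a sequence of parts.\<close>

lemma det_sum_rows:
  fixes f :: "nat \<Rightarrow> nat \<Rightarrow> 'b \<Rightarrow> 'a :: comm_ring_1"
  assumes "\<And>i. i < N \<Longrightarrow> finite (S i)"
  shows "det (mat N N (\<lambda>(i, j). \<Sum>l\<in>S i. f i j l))
    = (\<Sum>g\<in>PiE {..<N} S. det (mat N N (\<lambda>(i, j). f i j (g i))))"
proof -
  have "(\<Prod>i<N. \<Sum>l\<in>S i. f i (p i) l) = (\<Sum>g\<in>PiE {..<N} S. \<Prod>i<N. f i (p i) (g i))" for p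
    using assms by (intro prod_sum_PiE) auto
  then show ?thesis
    unfolding det_mat_permutes by (subst sum.swap) (simp add: sum_distrib_left)
qed

lemma det_scale_rows:
  fixes f :: "nat \<Rightarrow> nat \<Rightarrow> 'a :: comm_ring_1"
  shows "det (mat N N (\<lambda>(i, j). c i * f i j)) = (\<Prod>i<N. c i) * det (mat N N (\<lambda>(i, j). f i j))"
  unfolding det_mat_permutes by (simp add: prod.distrib sum_distrib_left ac_simps)

lemma det_mat_transpose:
  "det (mat N N (\<lambda>(i, j). f j i)) = det (mat N N (\<lambda>(i, j). f i j))"
proof -
  have "mat N N (\<lambda>(i, j). f j i) = transpose_mat (mat N N (\<lambda>(i, j). f i j))"
    by (rule eq_matI) auto
  then show ?thesis by (simp add: det_transpose[of _ N])
qed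

lemma det_of_int:
  "det (mat N N (\<lambda>(i, j). of_int (f i j))) = (of_int :: int \<Rightarrow> 'a :: comm_ring_1) (det (mat N N (\<lambda>(i, j). f i j)))"
proof -
  have "mat N N (\<lambda>(i, j). of_int (f i j)) = map_mat (of_int :: int \<Rightarrow> 'a) (mat N N (\<lambda>(i, j). f i j))"
    by (rule eq_matI) auto
  then show ?thesis by (simp only: of_int_hom.hom_det)
qed

text \<open>All subtractions happen at once, each with the original previous row; this is left
  multiplication by a unit lower bidiagonal matrix.\<close>

lemma det_subtract_previous_rows:
  fixes f :: "nat \<Rightarrow> nat \<Rightarrow> 'a :: comm_ring_1"
  shows "det (mat N N (\<lambda>(i, j). if i = 0 then f i j else f i j - c i * f (i - 1) j))
    = det (mat N N (\<lambda>(i, j). f i j))"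
proof -
  let ?L = "mat N N (\<lambda>(i, k). if k = i then 1 else if Suc k = i then - c i else 0)"
  let ?A = "mat N N (\<lambda>(i, j). f i j)"
  have "mat N N (\<lambda>(i, j). if i = 0 then f i j else f i j - c i * f (i - 1) j) = ?L * ?A"
  proof (rule eq_matI)
    fix i j assume ij: "i < dim_row (?L * ?A)" "j < dim_col (?L * ?A)"
    have "(?L * ?A) $$ (i, j)
      = (\<Sum>k = 0..<N. (if k = i then f i j else 0) + (if Suc k = i then - c i * f (i - 1) j else 0))"
      using ij by (auto simp: scalar_prod_def intro!: sum.cong)
    also have "\<dots> = f i j + (if i = 0 then 0 else - c i * f (i - 1) j)"
    proof (cases i)
      case 0
      then show ?thesis using ij by (simp add: sum.distrib)
    next
      case (Suc m)
      then show ?thesis using ij by (simp add: sum.distrib)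
    qed
    finally show "mat N N (\<lambda>(i, j). if i = 0 then f i j else f i j - c i * f (i - 1) j) $$ (i, j)
      = (?L * ?A) $$ (i, j)" using ij by simp
  qed auto
  moreover have "det ?L = 1"
    by (subst det_lower_triangular[of N]) (auto simp: prod_list_diag_prod)
  ultimately show ?thesis by (simp add: det_mult[of _ N])
qed

text \<open>Right multiplication by a unit lower bidiagonal matrix; the last column has no successor
  and stays.\<close>

lemma det_subtract_next_columns:
  fixes f :: "nat \<Rightarrow> nat \<Rightarrow> 'a :: comm_ring_1"
  shows "det (mat N N (\<lambda>(i, j). if Suc j = N then f i j else f i j - c j * f i (Suc j)))
    = det (mat N N (\<lambda>(i, j). f i j))"
proof -
  let ?R = "mat N N (\<lambda>(k, j). if k = j then 1 else if k = Suc j then - c j else 0)"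
  let ?A = "mat N N (\<lambda>(i, j). f i j)"
  have "mat N N (\<lambda>(i, j). if Suc j = N then f i j else f i j - c j * f i (Suc j)) = ?A * ?R"
  proof (rule eq_matI)
    fix i j assume ij: "i < dim_row (?A * ?R)" "j < dim_col (?A * ?R)"
    have "(?A * ?R) $$ (i, j)
      = (\<Sum>k = 0..<N. (if k = j then f i j else 0) + (if k = Suc j then - c j * f i (Suc j) else 0))"
      using ij by (auto simp: scalar_prod_def intro!: sum.cong)
    also have "\<dots> = f i j + (if Suc j = N then 0 else - c j * f i (Suc j))"
      using ij by (simp add: sum.distrib)
    finally show "mat N N (\<lambda>(i, j). if Suc j = N then f i j else f i j - c j * f i (Suc j)) $$ (i, j)
      = (?A * ?R) $$ (i, j)" using ij by simp
  qed auto
  moreover have "det ?R = 1"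
    by (subst det_lower_triangular[of N]) (auto simp: prod_list_diag_prod)
  ultimately show ?thesis by (simp add: det_mult[of _ N])
qed

section \<open>Determinants of power series up to a fixed degree\<close>

lemma fps_prod_nth_cong:
  fixes f g :: "'b \<Rightarrow> 'a :: comm_ring_1 fps"
  assumes "\<And>i m. i \<in> A \<Longrightarrow> m \<le> k \<Longrightarrow> fps_nth (f i) m = fps_nth (g i) m"
  shows "m \<le> k \<Longrightarrow> fps_nth (\<Prod>i\<in>A. f i) m = fps_nth (\<Prod>i\<in>A. g i) m"
  using assms
proof (induction A arbitrary: m rule: infinite_finite_induct)
  case (insert x A)
  then show ?case by (auto simp: fps_mult_nth intro!: sum.cong)
qed auto

text \<open>Determinants may be computed modulo \<open>fps_X ^ Suc k\<close>; this hides the capping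
  of the first part in \<open>sum_horizontal_strips_above\<close>.\<close>

lemma fps_det_nth_cong:
  fixes f g :: "nat \<Rightarrow> nat \<Rightarrow> 'a :: comm_ring_1 fps"
  assumes "\<And>i j m. i < N \<Longrightarrow> j < N \<Longrightarrow> m \<le> k \<Longrightarrow> fps_nth (f i j) m = fps_nth (g i j) m"
  shows "fps_nth (det (mat N N (\<lambda>(i, j). f i j))) k = fps_nth (det (mat N N (\<lambda>(i, j). g i j))) k"
proof -
  have "fps_nth (\<Prod>i<N. f i (p i)) m = fps_nth (\<Prod>i<N. g i (p i)) m"
    if "p permutes {..<N}" "m \<le> k" for p m
    using permutes_in_image[OF that(1)] that(2) assms by (intro fps_prod_nth_cong[where k = k]) auto
  then show ?thesis
    unfolding det_mat_permutes fps_sum_nth by (auto simp: fps_mult_nth intro!: sum.cong)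
qed


section \<open>Partitions\<close>

lemma part_eq_0_iff: "is_partition lam \<Longrightarrow> part lam i = 0 \<longleftrightarrow> length lam \<le> i"
  by (metis is_partition_def not_le nth_mem part_def)

lemma partition_eqI:
  assumes "is_partition lam" "is_partition mu" "\<And>i. part lam i = part mu i"
  shows "lam = mu"
proof (rule nth_equalityI)
  show len: "length lam = length mu"
    using assms part_eq_0_iff by (metis order.antisym order.refl)
  show "lam ! i = mu ! i" if "i < length lam" for i
    using assms(3)[of i] that len by (simp add: part_def)
qed

lemma partition_exists:
  fixes p :: "nat \<Rightarrow> nat"
  assumes "antimono p" "p N = 0"
  obtains lam where "is_partition lam" "part lam = p" "length lam \<le> N"
proof
  define l where "l = (LEAST i. p i = 0)"
  have l: "p l = 0" "l \<le> N" unfolding l_def using assms(2) by (auto intro: LeastI Least_le)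
  have pos: "p i \<noteq> 0" if "i < l" for i using that not_less_Least unfolding l_def by auto
  have zero: "p i = 0" if "l \<le> i" for i using antimonoD[OF assms(1) that] l by simp
  show "is_partition (map p [0..<l])"
    using antimonoD[OF assms(1)] pos by (auto simp: is_partition_def sorted_wrt_iff_nth_less) (metis neq0_conv)
  show "part (map p [0..<l]) = p" using zero by (auto simp: part_def fun_eq_iff)
  show "length (map p [0..<l]) \<le> N" using l by simp
qed

lemma sum_part:
  assumes "length lam \<le> N"
  shows "(\<Sum>i<N. part lam i) = sum_list lam"
proof -
  have "(\<Sum>i<N. part lam i) = (\<Sum>i<length lam. part lam i)"
    by (rule sum.mono_neutral_right) (use assms in \<open>auto simp: part_def\<close>)
  also have "\<dots> = sum_list lam" by (simp add: part_def sum_list_sum_nth atLeast0LessThan)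
  finally show ?thesis .
qed

text \<open>The hypothesis on neighbouring sets makes every choice function weakly decreasing, so
  each one, extended by zeros, is a partition: the parts vary independently.\<close>

lemma bij_betw_part_PiE:
  assumes "\<And>i l l'. Suc i < N \<Longrightarrow> l \<in> S i \<Longrightarrow> l' \<in> S (Suc i) \<Longrightarrow> l' \<le> l"
  shows "bij_betw (\<lambda>lam. restrict (part lam) {..<N})
    {lam. is_partition lam \<and> length lam \<le> N \<and> (\<forall>i<N. part lam i \<in> S i)} (PiE {..<N} S)"
  unfolding bij_betw_def
proof
  show "inj_on (\<lambda>lam. restrict (part lam) {..<N})
      {lam. is_partition lam \<and> length lam \<le> N \<and> (\<forall>i<N. part lam i \<in> S i)}"
  proof (rule inj_onI, safe)
    fix lam mu :: "nat list" assume p: "is_partition lam" "is_partition mu" "length lam \<le> N" "length mu \<le> N"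
      and eq: "restrict (part lam) {..<N} = restrict (part mu) {..<N}"
    have "part lam i = part mu i" for i
      using fun_cong[OF eq, of i] p by (cases "i < N") (auto simp: part_def)
    then show "lam = mu" using p by (intro partition_eqI)
  qed
  show "(\<lambda>lam. restrict (part lam) {..<N}) `
      {lam. is_partition lam \<and> length lam \<le> N \<and> (\<forall>i<N. part lam i \<in> S i)} = PiE {..<N} S"
  proof (intro equalityI subsetI)
    fix g assume g: "g \<in> PiE {..<N} S"
    define p where "p i = (if i < N then g i else 0)" for i
    have "p (Suc i) \<le> p i" for i
      using assms[of i "g i" "g (Suc i)"] g by (auto simp: p_def PiE_iff)
    then have "antimono p" unfolding antimono_iff_le_Suc by blast
    moreover have "p N = 0" by (simp add: p_def)
    ultimately obtain lam where lam: "is_partition lam" "part lam = p" "length lam \<le> N"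
      by (rule partition_exists)
    have "restrict (part lam) {..<N} = g"
      using g by (auto simp: lam p_def fun_eq_iff PiE_iff extensional_def)
    moreover have "\<forall>i<N. part lam i \<in> S i" using g by (auto simp: lam p_def)
    ultimately show "g \<in> (\<lambda>lam. restrict (part lam) {..<N}) `
      {lam. is_partition lam \<and> length lam \<le> N \<and> (\<forall>i<N. part lam i \<in> S i)}"
      using lam by blast
  qed (auto split: if_splits)
qed


section \<open>Horizontal strips and determinants\<close>

text \<open>The coefficient of \<open>t\<^sup>c\<close> in \<open>1 / (1 - t\<^sup>n)\<close>.\<close>

definition mult_ind :: "nat \<Rightarrow> int \<Rightarrow> int" where
  "mult_ind n c = (if 0 \<le> c \<and> int n dvd c then 1 else 0)"

text \<open>
  The determinant of \<open>M(\<lambda>/\<mu>)\<close>, padded to size \<open>N\<close>; the padding makes its size independent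
  of \<open>\<lambda>\<close>.
\<close>

definition skew_det :: "nat \<Rightarrow> nat \<Rightarrow> (nat \<Rightarrow> nat) \<Rightarrow> (nat \<Rightarrow> nat) \<Rightarrow> int" where
  "skew_det n N p q = det (mat N N (\<lambda>(i, j). mult_ind n (int (p i) - int i - int (q j) + int j)))"

lemma skew_det_cong:
  assumes "\<And>i. i < N \<Longrightarrow> p i = p' i" "\<And>i. i < N \<Longrightarrow> q i = q' i"
  shows "skew_det n N p q = skew_det n N p' q'"
  unfolding skew_det_def by (rule arg_cong[where f = det], rule eq_matI) (auto simp: assms)

text \<open>For \<open>c \<le> 0\<close> and \<open>n > 0\<close> this is
  \<open>x^(-c) / (1 - x^n)\<close>; for positive \<open>c\<close> it is the coefficient sequence of
  \<open>1 / (1 - t^n)\<close> read from position \<open>c\<close> on.\<close>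

definition mult_series :: "nat \<Rightarrow> int \<Rightarrow> int fps" where
  "mult_series n c = Abs_fps (\<lambda>s. mult_ind n (c + int s))"

text \<open>A finite segment is a full series minus its shifted tail. For an interval of parts this
  tail will belong to a neighbouring row or column.\<close>

lemma mult_series_split:
  "(\<Sum>t<d. fps_X ^ t * of_int (mult_ind n (c + int t)))
    = mult_series n c - fps_X ^ d * mult_series n (c + int d)"
proof (rule fps_ext)
  fix k
  have "fps_nth (\<Sum>t<d. fps_X ^ t * of_int (mult_ind n (c + int t))) k
      = (\<Sum>t<d. if t = k then mult_ind n (c + int t) else 0)"
    unfolding fps_sum_nth
    by (intro sum.cong refl) (auto simp: fps_X_power_mult_nth simp flip: fps_of_int)
  also have "\<dots> = (if k < d then mult_ind n (c + int k) else 0)" by simp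
  also have "\<dots> = fps_nth (mult_series n c - fps_X ^ d * mult_series n (c + int d)) k"
    by (auto simp: mult_series_def fps_X_power_mult_nth add.assoc simp flip: of_nat_add)
  finally show "fps_nth (\<Sum>t<d. fps_X ^ t * of_int (mult_ind n (c + int t))) k
    = fps_nth (mult_series n c - fps_X ^ d * mult_series n (c + int d)) k" .
qed

text \<open>Interlacing form of "at most one box per column". Each part is confined to an interval
  determined by the other partition alone, which suits the multilinear expansion.\<close>

definition horizontal_strip :: "nat list \<Rightarrow> nat list \<Rightarrow> bool" where
  "horizontal_strip lam nu \<longleftrightarrow> (\<forall>i. part lam (Suc i) \<le> part nu i \<and> part nu i \<le> part lam i)"

text \<open>Each choice carries a monomial whose degree is the sum of its exponents, so one
  coefficient selects the choices of that total degree; \<open>e\<close> will count boxes row by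
  row.\<close>

lemma fps_det_sum_rows_nth:
  fixes z :: "nat \<Rightarrow> nat \<Rightarrow> nat \<Rightarrow> int"
  assumes "\<And>i. i < N \<Longrightarrow> finite (S i)"
  shows "fps_nth (det (mat N N (\<lambda>(i, j). \<Sum>l\<in>S i. fps_X ^ e i l * of_int (z i j l)))) m
    = (\<Sum>g | g \<in> PiE {..<N} S \<and> (\<Sum>i<N. e i (g i)) = m. det (mat N N (\<lambda>(i, j). z i j (g i))))"
proof -
  have "fps_nth (det (mat N N (\<lambda>(i, j). fps_X ^ e i (g i) * of_int (z i j (g i))))) m
      = (if (\<Sum>i<N. e i (g i)) = m then det (mat N N (\<lambda>(i, j). z i j (g i))) else 0)" for g
    unfolding det_scale_rows det_of_int power_sum[symmetric]
    by (auto simp: fps_X_power_mult_nth simp flip: fps_of_int)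
  then have "fps_nth (det (mat N N (\<lambda>(i, j). \<Sum>l\<in>S i. fps_X ^ e i l * of_int (z i j l)))) m
    = (\<Sum>g\<in>PiE {..<N} S. if (\<Sum>i<N. e i (g i)) = m then det (mat N N (\<lambda>(i, j). z i j (g i))) else 0)"
    using assms by (simp add: det_sum_rows fps_sum_nth)
  also have "\<dots> = (\<Sum>g | g \<in> PiE {..<N} S \<and> (\<Sum>i<N. e i (g i)) = m. det (mat N N (\<lambda>(i, j). z i j (g i))))"
  proof (subst sum.inter_filter[symmetric])
    show "finite (PiE {..<N} S)" by (rule finite_PiE) (auto simp: assms)
  qed (simp add: conj_commute)
  finally show ?thesis .
qed

text \<open>Turns the expansion over choice functions into a sum over partitions; \<open>P\<close>
  and \<open>f\<close> may only see the first \<open>N\<close> values, since restriction forgets the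
  others.\<close>

lemma sum_PiE_partitions:
  assumes "\<And>i l l'. Suc i < N \<Longrightarrow> l \<in> S i \<Longrightarrow> l' \<in> S (Suc i) \<Longrightarrow> l' \<le> l"
    and "\<And>lam. P (restrict (part lam) {..<N}) = P (part lam)"
    and "\<And>lam. f (restrict (part lam) {..<N}) = f (part lam)"
  shows "(\<Sum>g | g \<in> PiE {..<N} S \<and> P g. f g)
    = (\<Sum>lam | is_partition lam \<and> length lam \<le> N \<and> (\<forall>i<N. part lam i \<in> S i) \<and> P (part lam). f (part lam))"
proof (rule sum.reindex_bij_betw[symmetric, THEN trans])
  let ?r = "\<lambda>lam. restrict (part lam) {..<N}"
  let ?A = "{lam. is_partition lam \<and> length lam \<le> N \<and> (\<forall>i<N. part lam i \<in> S i)}"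
  have b: "bij_betw ?r ?A (PiE {..<N} S)" by (rule bij_betw_part_PiE) (fact assms(1))
  show "bij_betw ?r {lam \<in> ?A. P (part lam)} {g. g \<in> PiE {..<N} S \<and> P g}"
    unfolding bij_betw_def
  proof
    show "inj_on ?r {lam \<in> ?A. P (part lam)}" using b by (auto simp: bij_betw_def intro: inj_on_subset)
    show "?r ` {lam \<in> ?A. P (part lam)} = {g. g \<in> PiE {..<N} S \<and> P g}"
    proof (intro equalityI subsetI)
      fix g assume "g \<in> {g. g \<in> PiE {..<N} S \<and> P g}"
      moreover from this have "g \<in> ?r ` ?A" using b by (simp add: bij_betw_def)
      then obtain lam where "lam \<in> ?A" "g = ?r lam" by blast
      ultimately show "g \<in> ?r ` {lam \<in> ?A. P (part lam)}" using assms(2) by auto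
    qed (use assms(2) in \<open>auto split: if_splits\<close>)
  qed
qed (auto intro!: sum.cong simp: assms(3))

lemma sum_shift_interval:
  fixes f :: "nat \<Rightarrow> 'a :: comm_monoid_add"
  shows "(\<Sum>l\<in>{a..<a + d}. f l) = (\<Sum>t<d. f (a + t))"
  by (rule sum.reindex_bij_witness[of _ "\<lambda>t. a + t" "\<lambda>l. l - a"]) auto

text \<open>
  The parts of \<open>\<lambda>\<close> range over independent intervals, so the sum is one determinant whose \<open>i\<close>-th row
  is the difference of two consecutive rows of the right-hand side. Since the coefficient of
  \<open>x\<^sup>m\<close> is sought, the first part, which is not bounded by \<open>\<nu>\<close>, may be capped at \<open>\<nu>\<^sub>0 + m\<close>.
\<close>

lemma sum_horizontal_strips_above:
  assumes nu: "is_partition nu" and len: "length nu < N"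
  shows "(\<Sum>lam | is_partition lam \<and> horizontal_strip lam nu \<and> sum_list lam = sum_list nu + m.
      skew_det n N (part lam) q)
    = fps_nth (det (mat N N (\<lambda>(i, j). mult_series n (int (part nu i) - int i - int (q j) + int j)))) m"
proof -
  define c where "c i j = int (part nu i) - int i - int (q j) + int j" for i j
  \<comment> \<open>The number of values allowed for part \<open>i\<close>: \<open>m + 1\<close> in
    row 0 because of the cap, otherwise those from \<open>part nu i\<close> to
    \<open>part nu (i - 1)\<close> inclusive.\<close>
  define d where "d i = (if i = 0 then Suc m else Suc (part nu (i - 1) - part nu i))" for i
  define S where "S i = {part nu i..<part nu i + d i}" for i
  define z where "z i j l = mult_ind n (int l - int i - int (q j) + int j)" for i j l
  have anti: "part nu j \<le> part nu i" if "i \<le> j" for i j by (rule part_antimono[OF nu that])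
  have row: "(\<Sum>l\<in>S i. fps_X ^ (l - part nu i) * of_int (z i j l))
      = mult_series n (c i j) - fps_X ^ d i * mult_series n (c i j + int (d i))" for i j
    unfolding mult_series_split[symmetric] S_def sum_shift_interval
    by (simp add: z_def c_def algebra_simps)
  \<comment> \<open>The \<open>Suc\<close> in \<open>d\<close> absorbs the change from
    \<open>- i\<close> to \<open>- (i - 1)\<close>, so the tail subtracted in row \<open>i\<close>
    is a multiple of row \<open>i - 1\<close>.\<close>
  have prev: "c i j + int (d i) = c (i - 1) j" if "i \<noteq> 0" for i j
    using that anti[of "i - 1" i] by (simp add: c_def d_def of_nat_diff)
  let ?Q = "\<lambda>p. (\<Sum>i<N. p i - part nu i) = m"
  have "fps_nth (det (mat N N (\<lambda>(i, j). mult_series n (c i j)))) m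
    = fps_nth (det (mat N N (\<lambda>(i, j). if i = 0 then mult_series n (c i j)
        else mult_series n (c i j) - fps_X ^ d i * mult_series n (c (i - 1) j)))) m"
    by (subst det_subtract_previous_rows) (rule refl)
  \<comment> \<open>Row 0 agrees only modulo \<open>fps_X ^ Suc m\<close>, which the coefficient at
    \<open>m\<close> cannot detect.\<close>
  also have "\<dots> = fps_nth (det (mat N N (\<lambda>(i, j).
      \<Sum>l\<in>S i. fps_X ^ (l - part nu i) * of_int (z i j l)))) m"
    unfolding row
  proof (rule fps_det_nth_cong, goal_cases)
    case (1 i j k)
    then show ?case
      by (cases "i = 0") (auto simp: prev fps_X_power_mult_nth, auto simp: d_def)
  qed
  also have "\<dots> = (\<Sum>g | g \<in> PiE {..<N} S \<and> ?Q g. det (mat N N (\<lambda>(i, j). z i j (g i))))"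
    by (rule fps_det_sum_rows_nth) (simp add: S_def)
  also have "\<dots> = (\<Sum>g | g \<in> PiE {..<N} S \<and> ?Q g. skew_det n N g q)"
    by (simp add: skew_det_def z_def)
  also have "\<dots> = (\<Sum>lam | is_partition lam \<and> length lam \<le> N \<and> (\<forall>i<N. part lam i \<in> S i) \<and> ?Q (part lam).
      skew_det n N (part lam) q)"
    by (rule sum_PiE_partitions) (auto simp: S_def d_def anti intro: skew_det_cong)
  also have "{lam. is_partition lam \<and> length lam \<le> N \<and> (\<forall>i<N. part lam i \<in> S i) \<and> ?Q (part lam)}
    = {lam. is_partition lam \<and> horizontal_strip lam nu \<and> sum_list lam = sum_list nu + m}"
  proof (rule Collect_cong, rule conj_cong[OF refl])
    fix lam assume lam: "is_partition lam"
    have *: "?Q (part lam) \<longleftrightarrow> sum_list lam = sum_list nu + m"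
      if "length lam \<le> N" "\<And>i. i < N \<Longrightarrow> part nu i \<le> part lam i"
    proof -
      have "(\<Sum>i<N. part lam i - part nu i) = sum_list lam - sum_list nu"
        by (subst sum_subtractf_nat) (use that len in \<open>auto simp: sum_part\<close>)
      moreover have "sum_list nu \<le> sum_list lam"
        using sum_mono[of "{..<N}" "part nu" "part lam"] that len by (simp add: sum_part)
      ultimately show ?thesis by auto
    qed
    show "length lam \<le> N \<and> (\<forall>i<N. part lam i \<in> S i) \<and> ?Q (part lam)
      \<longleftrightarrow> horizontal_strip lam nu \<and> sum_list lam = sum_list nu + m"
    proof (intro iffI conjI allI impI; elim conjE)
      assume h: "length lam \<le> N" "\<forall>i<N. part lam i \<in> S i" "?Q (part lam)"
      have ge: "part nu i \<le> part lam i" if "i < N" for i using h(2) that by (auto simp: S_def)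
      then show "sum_list lam = sum_list nu + m" using * h by blast
    next
      assume h: "length lam \<le> N" "\<forall>i<N. part lam i \<in> S i" "?Q (part lam)"
      have ge: "part nu i \<le> part lam i" if "i < N" for i using h(2) that by (auto simp: S_def)
      have "part lam (Suc i) \<le> part nu i" for i
      proof (cases "Suc i < N")
        case True
        then have "part lam (Suc i) \<in> S (Suc i)" using h(2) by blast
        then show ?thesis using anti[of i "Suc i"] by (simp add: S_def d_def)
      next
        case False
        then show ?thesis using h(1) by (simp add: part_def)
      qed
      moreover have "part nu i \<le> part lam i" for i
        using ge[of i] len by (cases "i < N") (auto simp: part_def)
      ultimately show "horizontal_strip lam nu" by (simp add: horizontal_strip_def)
    next
      assume h: "horizontal_strip lam nu" "sum_list lam = sum_list nu + m"
      have a: "part lam (Suc i) \<le> part nu i" "part nu i \<le> part lam i" for i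
        using h(1) by (auto simp: horizontal_strip_def)
      \<comment> \<open>The strict bound on \<open>length nu\<close> leaves room for the one row
        that a horizontal strip can add.\<close>
      have "part nu (N - 1) = 0" using len by (simp add: part_def)
      then have "part lam N = 0" using a(1)[of "N - 1"] len by simp
      then show l: "length lam \<le> N" using part_eq_0_iff[OF lam] by simp
      show Q: "?Q (part lam)" using * l a h by blast
      fix i assume i: "i < N"
      \<comment> \<open>A single row gains at most all \<open>m\<close> new boxes, which justifies
        the cap.\<close>
      have "part lam i - part nu i \<le> m" if "i = 0"
        using member_le_sum[of i "{..<N}" "\<lambda>i. part lam i - part nu i"] i Q by simp
      then show "part lam i \<in> S i"
        using a(2)[of i] a(1)[of "i - 1"] anti[of "i - 1" i] by (auto simp: S_def d_def)
    qed
  qed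
  finally show ?thesis by (simp add: c_def)
qed

text \<open>The counterpart for removal: the intervals now belong to the columns and are all
  bounded, so the identity is exact in every degree. Even the last column is differenced, against a
  column with index \<open>N\<close> outside the matrix.\<close>

lemma sum_horizontal_strips_below:
  assumes mu: "is_partition mu" and len: "length mu \<le> N"
  shows "(\<Sum>rho | is_partition rho \<and> horizontal_strip mu rho \<and> sum_list mu = sum_list rho + m.
      skew_det n N p (part rho))
    = fps_nth (det (mat N N (\<lambda>(i, j). mult_series n (int (p i) - int i - int (part mu j) + int j)
        - fps_X ^ Suc (part mu j - part mu (Suc j))
          * mult_series n (int (p i) - int i - int (part mu (Suc j)) + int (Suc j))))) m"
proof -
  define c where "c i j = int (p i) - int i - int (part mu j) + int j" for i j
  define d where "d j = Suc (part mu j - part mu (Suc j))" for j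
  define S where "S j = {part mu (Suc j)..part mu j}" for j
  define z where "z j i l = mult_ind n (int (p i) - int i - int l + int j)" for j i l
  have anti: "part mu j \<le> part mu i" if "i \<le> j" for i j by (rule part_antimono[OF mu that])
  have col: "(\<Sum>l\<in>S j. fps_X ^ (part mu j - l) * of_int (z j i l))
      = mult_series n (c i j) - fps_X ^ d j * mult_series n (c i (Suc j))" for i j
  proof -
    have "c i (Suc j) = c i j + int (d j)" using anti[of j "Suc j"] by (simp add: c_def d_def of_nat_diff)
    moreover have "(\<Sum>l\<in>S j. fps_X ^ (part mu j - l) * of_int (z j i l))
      = (\<Sum>t<d j. fps_X ^ t * of_int (mult_ind n (c i j + int t)))"
      \<comment> \<open>\<open>t\<close> counts the boxes removed from row \<open>j\<close>, so the
        interval is traversed downwards.\<close>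
      by (rule sum.reindex_bij_witness[of _ "\<lambda>t. part mu j - t" "\<lambda>l. part mu j - l"])
        (use anti[of j "Suc j"] in \<open>auto simp: S_def d_def z_def c_def of_nat_diff algebra_simps\<close>)
    ultimately show ?thesis by (metis mult_series_split)
  qed
  let ?Q = "\<lambda>q. (\<Sum>i<N. part mu i - q i) = m"
  have "fps_nth (det (mat N N (\<lambda>(i, j). mult_series n (c i j) - fps_X ^ d j * mult_series n (c i (Suc j))))) m
    = fps_nth (det (mat N N (\<lambda>(j, i). \<Sum>l\<in>S j. fps_X ^ (part mu j - l) * of_int (z j i l)))) m"
    unfolding col[symmetric] by (subst det_mat_transpose) (rule refl)
  also have "\<dots> = (\<Sum>g | g \<in> PiE {..<N} S \<and> ?Q g. det (mat N N (\<lambda>(j, i). z j i (g j))))"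
    by (rule fps_det_sum_rows_nth) (simp add: S_def)
  also have "\<dots> = (\<Sum>g | g \<in> PiE {..<N} S \<and> ?Q g. skew_det n N p g)"
    by (subst det_mat_transpose) (simp add: skew_det_def z_def)
  also have "\<dots> = (\<Sum>rho | is_partition rho \<and> length rho \<le> N \<and> (\<forall>i<N. part rho i \<in> S i) \<and> ?Q (part rho).
      skew_det n N p (part rho))"
    by (rule sum_PiE_partitions) (auto simp: S_def intro: skew_det_cong)
  also have "{rho. is_partition rho \<and> length rho \<le> N \<and> (\<forall>i<N. part rho i \<in> S i) \<and> ?Q (part rho)}
    = {rho. is_partition rho \<and> horizontal_strip mu rho \<and> sum_list mu = sum_list rho + m}"
  proof (rule Collect_cong, rule conj_cong[OF refl])
    fix rho assume rho: "is_partition rho"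
    have 1: "horizontal_strip mu rho \<longleftrightarrow> length rho \<le> N \<and> (\<forall>i<N. part rho i \<in> S i)"
    proof
      assume h: "horizontal_strip mu rho"
      then have "part rho N \<le> part mu N" by (simp add: horizontal_strip_def)
      then have "part rho N = 0" using len by (simp add: part_def)
      then show "length rho \<le> N \<and> (\<forall>i<N. part rho i \<in> S i)"
        using h part_eq_0_iff[OF rho] by (auto simp: S_def horizontal_strip_def)
    next
      assume "length rho \<le> N \<and> (\<forall>i<N. part rho i \<in> S i)"
      then have "part mu (Suc i) \<le> part rho i \<and> part rho i \<le> part mu i" for i
        using len by (cases "i < N") (auto simp: S_def part_def)
      then show "horizontal_strip mu rho" by (simp add: horizontal_strip_def)
    qed
    have 2: "?Q (part rho) \<longleftrightarrow> sum_list mu = sum_list rho + m"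
      if "length rho \<le> N" "\<forall>i<N. part rho i \<in> S i"
    proof -
      have le: "part rho i \<le> part mu i" if "i < N" for i using \<open>\<forall>i<N. _\<close> that by (auto simp: S_def)
      have "(\<Sum>i<N. part mu i - part rho i) = sum_list mu - sum_list rho"
        by (subst sum_subtractf_nat) (use that(1) len le in \<open>auto simp: sum_part\<close>)
      moreover have "sum_list rho \<le> sum_list mu"
        using sum_mono[of "{..<N}" "part rho" "part mu"] that len le by (simp add: sum_part)
      ultimately show ?thesis by auto
    qed
    show "length rho \<le> N \<and> (\<forall>i<N. part rho i \<in> S i) \<and> ?Q (part rho)
      \<longleftrightarrow> horizontal_strip mu rho \<and> sum_list mu = sum_list rho + m"
      unfolding 1 using 2 by blast
  qed
  finally show ?thesis by (simp only: c_def d_def)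
qed

text \<open>
  After the column operations the last row vanishes except for its corner
  \<^term>\<open>mult_series n 0\<close>, which is \<open>1 / (1 - x\<^sup>n)\<close>; the two determinants thus differ by this factor.
\<close>

lemma horizontal_strip_exchange:
  assumes mu: "is_partition mu" and nu: "is_partition nu"
    and len: "length mu \<le> L" "length nu \<le> L"
  shows "(\<Sum>lam | is_partition lam \<and> horizontal_strip lam nu \<and> sum_list lam = sum_list nu + m.
      skew_det n (Suc L) (part lam) (part mu))
    = (\<Sum>s | s \<le> m \<and> n dvd s.
        \<Sum>rho | is_partition rho \<and> horizontal_strip mu rho \<and> sum_list mu = sum_list rho + (m - s).
          skew_det n L (part nu) (part rho))"
proof -
  define c where "c i j = int (part nu i) - int i - int (part mu j) + int j" for i j
  define d where "d j = Suc (part mu j - part mu (Suc j))" for j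
  define R where "R i j = mult_series n (c i j) - fps_X ^ d j * mult_series n (c i (Suc j))" for i j
  let ?R = "det (mat L L (\<lambda>(i, j). R i j))"
  have below: "(\<Sum>rho | is_partition rho \<and> horizontal_strip mu rho \<and> sum_list mu = sum_list rho + k.
      skew_det n L (part nu) (part rho)) = fps_nth ?R k" for k
    unfolding sum_horizontal_strips_below[OF mu len(1)] R_def c_def d_def ..
  \<comment> \<open>Since \<open>part nu L = 0\<close>, the arguments of \<open>mult_ind\<close> in
    this row are at most \<open>j - L - part mu (Suc j)\<close>, hence negative.\<close>
  have "R L j = 0" if "j < L" for j
  proof -
    have le: "part mu (Suc j) \<le> part mu j" by (rule part_antimono[OF mu]) simp
    have nuL: "part nu L = 0" using len by (simp add: part_def)
    have "c L (Suc j) = c L j + int (d j)" using le by (simp add: c_def d_def of_nat_diff)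
    then have "R L j = (\<Sum>t<d j. fps_X ^ t * of_int (mult_ind n (c L j + int t)))"
      by (simp add: R_def mult_series_split)
    also have "\<dots> = 0"
      using that le by (intro sum.neutral) (auto simp: mult_ind_def c_def nuL d_def)
    finally show ?thesis .
  qed
  \<comment> \<open>In size \<open>Suc L\<close> column \<open>L\<close> is available as the
    successor of column \<open>L - 1\<close>, so the leading block is exactly the matrix
    \<open>R\<close> of size \<open>L\<close>.\<close>
  then have "det (mat (Suc L) (Suc L) (\<lambda>(i, j). if Suc j = Suc L then mult_series n (c i j) else R i j))
      = mult_series n (c L L) * det (mat L L (\<lambda>(i, j). if Suc j = Suc L then mult_series n (c i j) else R i j))"
    by (subst det_last_row) auto
  also have "mat L L (\<lambda>(i, j). if Suc j = Suc L then mult_series n (c i j) else R i j) = mat L L (\<lambda>(i, j). R i j)"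
    by (rule eq_matI) auto
  also have "det (mat (Suc L) (Suc L) (\<lambda>(i, j). if Suc j = Suc L then mult_series n (c i j) else R i j))
      = det (mat (Suc L) (Suc L) (\<lambda>(i, j). mult_series n (c i j)))"
    unfolding R_def by (rule det_subtract_next_columns)
  also have "c L L = 0" using len by (simp add: c_def part_def)
  finally have det: "det (mat (Suc L) (Suc L) (\<lambda>(i, j). mult_series n (c i j))) = mult_series n 0 * ?R" .
  have "(\<Sum>lam | is_partition lam \<and> horizontal_strip lam nu \<and> sum_list lam = sum_list nu + m.
      skew_det n (Suc L) (part lam) (part mu)) = fps_nth (mult_series n 0 * ?R) m"
    using sum_horizontal_strips_above[OF nu, where N = "Suc L" and m = m and n = n and q = "part mu"] len det by (simp add: c_def)
  \<comment> \<open>\<open>mult_series n 0\<close> contributes the multiples \<open>s\<close> of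
    \<open>n\<close>, the strip inside \<open>mu\<close> the remaining degree
    \<open>m - s\<close>.\<close>
  also have "\<dots> = (\<Sum>s\<in>{0..m}. if n dvd s then fps_nth ?R (m - s) else 0)"
    unfolding fps_mult_nth by (intro sum.cong) (auto simp: mult_series_def mult_ind_def)
  also have "\<dots> = (\<Sum>s | s \<le> m \<and> n dvd s. fps_nth ?R (m - s))"
    by (subst sum.inter_filter[symmetric]) (auto intro!: sum.cong)
  finally show ?thesis by (simp only: below)
qed


section \<open>Removing the largest entries of a tableau\<close>

lemma card_young_diagram: "card (young_diagram lam) = sum_list lam"
  by (simp add: young_diagram_Sigma sum_part)

lemma size_tableau_content: "size (tableau_content lam T) = sum_list lam"
  by (simp add: tableau_content_def card_young_diagram)

lemma ssyt_number_nonzero_size: "ssyt_number lam M \<noteq> 0 \<Longrightarrow> size M = sum_list lam"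
  unfolding ssyt_number_def using size_tableau_content by (metis (mono_tags, lifting) card.empty empty_Collect_eq)

lemma young_diagram_inject:
  assumes "is_partition lam" "is_partition mu" "young_diagram lam = young_diagram mu"
  shows "lam = mu"
proof (rule partition_eqI[OF assms(1,2)])
  fix i
  have "j < part lam i \<longleftrightarrow> j < part mu i" for j
    using assms(3) by (auto simp: young_diagram_def set_eq_iff)
  then show "part lam i = part mu i" by (metis linorder_neqE_nat less_irrefl)
qed

text \<open>The choice is unique by \<open>young_diagram_inject\<close>; existence for tableaux is
  part of \<open>small_shape_ssyt\<close>.\<close>

definition small_shape :: "nat list \<Rightarrow> nat \<Rightarrow> (nat \<times> nat \<Rightarrow> nat) \<Rightarrow> nat list" where
  "small_shape lam r T = (SOME nu. is_partition nu \<and> young_diagram nu = {p \<in> young_diagram lam. T p < r})"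

text \<open>The row lengths are the counts \<open>row_count lam T r\<close>, which decrease weakly
  because columns increase strictly.\<close>

lemma small_shape_ssyt:
  assumes lam: "is_partition lam" and T: "T \<in> ssyt lam"
  shows "is_partition (small_shape lam r T)"
    and "young_diagram (small_shape lam r T) = {p \<in> young_diagram lam. T p < r}"
proof -
  have "row_count lam T r (Suc i) \<le> row_count lam T r i" for i
    using row_count_mono[of r "Suc r" lam T "Suc i"] row_count_col[OF lam T, of r i] by simp
  then have "antimono (row_count lam T r)" unfolding antimono_iff_le_Suc by blast
  moreover have "row_count lam T r (length lam) = 0" by (simp add: row_count_length)
  ultimately obtain nu where nu: "is_partition nu" "part nu = row_count lam T r" by (rule partition_exists)
  have "young_diagram nu = {p \<in> young_diagram lam. T p < r}"
    using row_count_iff[OF T, of _ _ r] row_count_le[of lam T r]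
    by (auto simp: young_diagram_def nu(2)) (meson order.strict_trans2)+
  with nu(1) have "\<exists>nu. is_partition nu \<and> young_diagram nu = {p \<in> young_diagram lam. T p < r}" by blast
  then have "is_partition (small_shape lam r T) \<and>
      young_diagram (small_shape lam r T) = {p \<in> young_diagram lam. T p < r}"
    unfolding small_shape_def by (rule someI_ex)
  then show "is_partition (small_shape lam r T)"
    "young_diagram (small_shape lam r T) = {p \<in> young_diagram lam. T p < r}" by blast+
qed

lemma horizontal_strip_iff:
  "horizontal_strip lam nu \<longleftrightarrow> young_diagram nu \<subseteq> young_diagram lam \<and>
     (\<forall>i j. (Suc i, j) \<in> young_diagram lam \<longrightarrow> (i, j) \<in> young_diagram nu)"
proof -
  have "part nu i \<le> part lam i \<longleftrightarrow> (\<forall>j. j < part nu i \<longrightarrow> j < part lam i)" for i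
    by (meson order.strict_trans2 not_le less_irrefl)
  moreover have "part lam (Suc i) \<le> part nu i \<longleftrightarrow> (\<forall>j. j < part lam (Suc i) \<longrightarrow> j < part nu i)" for i
    by (meson order.strict_trans2 not_le less_irrefl)
  ultimately show ?thesis unfolding horizontal_strip_def young_diagram_def by blast
qed

text \<open>A bijection: \<open>cut\<close> removes the boxes filled with \<open>r\<close> and
  records the remaining shape, \<open>glue\<close> fills the strip with \<open>r\<close>
  again.\<close>

lemma ssyt_number_add_replicate:
  assumes lam: "is_partition lam" and M: "set_mset M \<subseteq> {..<r}"
  shows "ssyt_number lam (M + replicate_mset m r)
    = (\<Sum>nu | is_partition nu \<and> horizontal_strip lam nu \<and> sum_list lam = sum_list nu + m. ssyt_number nu M)"
proof -
  let ?H = "{nu. is_partition nu \<and> horizontal_strip lam nu \<and> sum_list lam = sum_list nu + m}"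
  let ?X = "{T \<in> ssyt lam. tableau_content lam T = M + replicate_mset m r}"
  let ?Y = "SIGMA nu:?H. {U \<in> ssyt nu. tableau_content nu U = M}"
  define cut where "cut T = (small_shape lam r T, restrict T (young_diagram (small_shape lam r T)))" for T
  \<comment> \<open>The value \<open>undefined\<close> outside the diagram keeps the filling
    extensional, as \<open>ssyt\<close> requires.\<close>
  define glue where "glue = (\<lambda>(nu, U) p. if p \<in> young_diagram nu then U p
    else if p \<in> young_diagram lam then r else undefined :: nat)"
  have filterM: "filter_mset (\<lambda>x. x < r) (M + replicate_mset m r) = M"
  proof (rule multiset_eqI)
    fix x
    have "count M x = 0" if "\<not> x < r" using M that by (auto simp: count_eq_zero_iff)
    then show "count (filter_mset (\<lambda>x. x < r) (M + replicate_mset m r)) x = count M x" by simp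
  qed
  have cut: "cut T \<in> ?Y \<and> glue (cut T) = T" if T: "T \<in> ?X" for T
  proof -
    have ssyt: "T \<in> ssyt lam" and content: "tableau_content lam T = M + replicate_mset m r"
      using T by auto
    define nu where "nu = small_shape lam r T"
    have nu: "is_partition nu" and yd: "young_diagram nu = {p \<in> young_diagram lam. T p < r}"
      unfolding nu_def by (rule small_shape_ssyt[OF lam ssyt])+
    have "T p \<in># M + replicate_mset m r" if "p \<in> young_diagram lam" for p
      using that unfolding content[symmetric] by (simp add: tableau_content_def finite_young_diagram)
    moreover have "x \<in># M + replicate_mset m r \<Longrightarrow> x \<in># M \<or> x = r" for x
      by (auto split: if_splits)
    ultimately have le: "T p < Suc r" if "p \<in> young_diagram lam" for p
      using that M less_Suc_eq by (meson lessThan_iff subsetD)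
    have row: "T (i, j) \<le> T (i, Suc j)" if "(i, Suc j) \<in> young_diagram lam" for i j
      using ssyt that unfolding ssyt_def by blast
    have col: "T (i, j) < T (Suc i, j)" if "(Suc i, j) \<in> young_diagram lam" for i j
      using ssyt that unfolding ssyt_def by blast
    have undef: "T p = undefined" if "p \<notin> young_diagram lam" for p
      using ssyt that unfolding ssyt_def by blast
    have above: "(i, j) \<in> young_diagram lam" if "(Suc i, j) \<in> young_diagram lam" for i j
      using that part_antimono[OF lam, of i "Suc i"] by (auto simp: young_diagram_def)
    \<comment> \<open>The entry above a box is strictly smaller than an entry that is at most
      \<open>r\<close>, so it survives the cut.\<close>
    have hs: "horizontal_strip lam nu"
      unfolding horizontal_strip_iff
    proof (intro conjI allI impI)
      show "young_diagram nu \<subseteq> young_diagram lam" using yd by blast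
    next
      fix i j assume "(Suc i, j) \<in> young_diagram lam"
      then show "(i, j) \<in> young_diagram nu"
        unfolding yd using above[of i j] col[of i j] le[of "(Suc i, j)"] by simp
    qed
    have "restrict T (young_diagram nu) \<in> ssyt nu"
    proof -
      have left: "(i, j) \<in> young_diagram nu" if "(i, Suc j) \<in> young_diagram nu" for i j
        using that by (auto simp: young_diagram_def)
      have up: "(i, j) \<in> young_diagram nu" if "(Suc i, j) \<in> young_diagram nu" for i j
        using that above[of i j] col[of i j] unfolding yd by auto
      have sub: "p \<in> young_diagram lam" if "p \<in> young_diagram nu" for p using that yd by blast
      show ?thesis
        unfolding ssyt_def
      proof (intro CollectI conjI allI impI)
        fix i j assume "(i, Suc j) \<in> young_diagram nu"
        then show "restrict T (young_diagram nu) (i, j) \<le> restrict T (young_diagram nu) (i, Suc j)"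
          using left[of i j] row[of i j] sub[of "(i, Suc j)"] by simp
      next
        fix i j assume "(Suc i, j) \<in> young_diagram nu"
        then show "restrict T (young_diagram nu) (i, j) < restrict T (young_diagram nu) (Suc i, j)"
          using up[of i j] col[of i j] sub[of "(Suc i, j)"] by simp
      qed simp
    qed
    moreover have "tableau_content nu (restrict T (young_diagram nu)) = M"
    proof -
      have "tableau_content nu (restrict T (young_diagram nu)) = image_mset T (mset_set (young_diagram nu))"
        unfolding tableau_content_def by (rule image_mset_cong) (simp add: finite_young_diagram)
      also have "\<dots> = filter_mset (\<lambda>x. x < r) (tableau_content lam T)"
        unfolding tableau_content_def yd
        by (simp add: filter_mset_image_mset finite_young_diagram)
      finally show ?thesis unfolding content filterM .
    qed
    moreover from this have "sum_list nu = size M" by (metis size_tableau_content)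
    moreover have "sum_list lam = size M + m" by (metis size_tableau_content content size_union size_replicate_mset)
    ultimately have "cut T \<in> ?Y" using nu hs by (simp add: cut_def nu_def)
    moreover have "glue (cut T) = T"
    proof
      fix p
      have "p \<in> young_diagram nu \<longleftrightarrow> p \<in> young_diagram lam \<and> T p < r" unfolding yd by simp
      then show "glue (cut T) p = T p"
        using le[of p] undef[of p] unfolding glue_def cut_def nu_def[symmetric] by (auto simp: less_Suc_eq)
    qed
    ultimately show ?thesis by blast
  qed
  have glue: "glue (nu, U) \<in> ?X \<and> cut (glue (nu, U)) = (nu, U)" if "(nu, U) \<in> ?Y" for nu U
  proof -
    let ?T = "glue (nu, U)"
    have nu: "is_partition nu" and hs: "horizontal_strip lam nu" and size: "sum_list lam = sum_list nu + m"
      and U: "U \<in> ssyt nu" and content: "tableau_content nu U = M" using that by auto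
    have sub: "young_diagram nu \<subseteq> young_diagram lam" using hs by (simp add: horizontal_strip_iff)
    have strip: "(i, j) \<in> young_diagram nu" if "(Suc i, j) \<in> young_diagram lam" for i j
      using hs that by (simp add: horizontal_strip_iff)
    have "U p \<in># M" if "p \<in> young_diagram nu" for p
      using that unfolding content[symmetric] by (simp add: tableau_content_def finite_young_diagram)
    then have less: "U p < r" if "p \<in> young_diagram nu" for p using M that by blast
    have row: "U (i, j) \<le> U (i, Suc j)" if "(i, Suc j) \<in> young_diagram nu" for i j
      using U that unfolding ssyt_def by blast
    have col: "U (i, j) < U (Suc i, j)" if "(Suc i, j) \<in> young_diagram nu" for i j
      using U that unfolding ssyt_def by blast
    have undef: "U p = undefined" if "p \<notin> young_diagram nu" for p
      using U that unfolding ssyt_def by blast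
    have left: "(i, j) \<in> young_diagram nu" if "(i, Suc j) \<in> young_diagram nu" for i j
      using that by (auto simp: young_diagram_def)
    have left': "(i, j) \<in> young_diagram lam" if "(i, Suc j) \<in> young_diagram lam" for i j
      using that by (auto simp: young_diagram_def)
    have ssyt: "?T \<in> ssyt lam"
      unfolding ssyt_def
    proof (intro CollectI conjI allI impI)
      show "?T \<in> young_diagram lam \<rightarrow>\<^sub>E UNIV" using sub by (auto simp: glue_def)
    next
      fix i j assume "(i, Suc j) \<in> young_diagram lam"
      then show "?T (i, j) \<le> ?T (i, Suc j)"
        using left[of i j] left'[of i j] row[of i j] less[of "(i, j)"] by (auto simp: glue_def)
    next
      fix i j assume "(Suc i, j) \<in> young_diagram lam"
      then show "?T (i, j) < ?T (Suc i, j)"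
        using strip[of i j] col[of i j] less[of "(i, j)"] by (auto simp: glue_def)
    qed
    have "mset_set (young_diagram lam) = mset_set (young_diagram nu) + mset_set (young_diagram lam - young_diagram nu)"
      using sub by (subst mset_set_Union[symmetric]) (auto simp: finite_young_diagram Un_absorb1)
    then have "tableau_content lam ?T = image_mset ?T (mset_set (young_diagram nu))
      + image_mset ?T (mset_set (young_diagram lam - young_diagram nu))"
      by (simp add: tableau_content_def)
    also have "image_mset ?T (mset_set (young_diagram nu)) = tableau_content nu U"
      unfolding tableau_content_def by (rule image_mset_cong) (simp add: finite_young_diagram glue_def)
    also have "image_mset ?T (mset_set (young_diagram lam - young_diagram nu))
      = image_mset (\<lambda>_. r) (mset_set (young_diagram lam - young_diagram nu))"
      by (rule image_mset_cong) (simp add: finite_young_diagram glue_def)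
    also have "\<dots> = replicate_mset m r"
      using sub by (simp add: image_mset_const_eq card_Diff_subset finite_young_diagram card_young_diagram size)
    finally have content': "tableau_content lam ?T = M + replicate_mset m r" by (simp only: content)
    have "young_diagram (small_shape lam r ?T) = young_diagram nu"
      using small_shape_ssyt(2)[OF lam ssyt] sub less by (auto simp: glue_def)
    then have shape: "small_shape lam r ?T = nu"
      using young_diagram_inject small_shape_ssyt(1)[OF lam ssyt] nu by blast
    have "restrict ?T (young_diagram nu) = U"
      using undef by (auto simp: fun_eq_iff glue_def)
    then show ?thesis using ssyt content' shape by (simp add: cut_def)
  qed
  have "bij_betw cut ?X ?Y"
  proof (rule bij_betw_byWitness[where f' = glue])
    show "\<forall>T\<in>?X. glue (cut T) = T" by (rule ballI, rule conjunct2, rule cut)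
    show "cut ` ?X \<subseteq> ?Y" by (rule image_subsetI, rule conjunct1, rule cut)
    have "glue p \<in> ?X \<and> cut (glue p) = p" if "p \<in> ?Y" for p
      using glue[of "fst p" "snd p", unfolded prod.collapse, OF that] .
    note glue' = this
    show "\<forall>p\<in>?Y. cut (glue p) = p" by (rule ballI, rule conjunct2, rule glue')
    show "glue ` ?Y \<subseteq> ?X" by (rule image_subsetI, rule conjunct1, rule glue')
  qed
  then have "card ?X = card ?Y" by (rule bij_betw_same_card)
  moreover have "finite ?H"
    by (rule finite_subset[OF _ finite_partitions[of "sum_list lam - m"]]) auto
  ultimately show ?thesis
    unfolding ssyt_number_def by (simp add: card_SigmaI finite_ssyt_content)
qed


section \<open>The skew Cauchy identity\<close>

text \<open>Containment forces \<open>mu\<close> to vanish wherever \<open>lam\<close> does, so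
  every padding row is zero up to its corner entry 1.\<close>

lemma skew_det_skew_matrix:
  assumes "part_subset mu lam" "length lam \<le> N"
  shows "skew_det n N (part lam) (part mu) = det (skew_matrix n lam mu)"
  using assms(2)
proof (induction rule: dec_induct)
  case base
  show ?case unfolding skew_det_def skew_matrix_def
    by (rule arg_cong[where f = det], rule eq_matI) (auto simp: mult_ind_def)
next
  case (step N)
  have "part lam N = 0" using step.hyps by (simp add: part_def)
  moreover from this have "part mu N = 0" using assms(1) unfolding part_subset_def by (metis le_zero_eq)
  ultimately show ?case
    using step.IH unfolding skew_det_def by (subst det_last_row) (auto simp: mult_ind_def)
qed

text \<open>Pigeonhole: the \<open>N - i\<close> indices from \<open>i\<close> on do not fit
  injectively into those above \<open>i\<close>. It locates a vanishing factor in each Leibniz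
  term.\<close>

lemma permutes_exists_le:
  fixes p :: "nat \<Rightarrow> nat"
  assumes "p permutes {..<N}" "i < N"
  obtains k where "i \<le> k" "k < N" "p k \<le> i"
proof -
  have "\<not> p ` {i..<N} \<subseteq> {i<..<N}"
  proof
    assume "p ` {i..<N} \<subseteq> {i<..<N}"
    then have "card (p ` {i..<N}) \<le> card {i<..<N}" by (intro card_mono) auto
    moreover have "card (p ` {i..<N}) = card {i..<N}"
      using permutes_inj[OF assms(1)] by (intro card_image) (auto intro: inj_on_subset)
    ultimately show False using assms(2) by simp
  qed
  then obtain k where "k \<in> {i..<N}" "p k \<notin> {i<..<N}" by blast
  with permutes_in_image[OF assms(1), of k] show thesis by (intro that[of k]) auto
qed

text \<open>If part \<open>i\<close> of \<open>lam\<close> is too small, all entries in rows from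
  \<open>i\<close> on and columns up to \<open>i\<close> have a negative argument, and every
  permutation meets this block.\<close>

lemma skew_det_not_subset:
  assumes lam: "is_partition lam" and mu: "is_partition mu"
    and "\<not> part_subset mu lam" "length mu \<le> N"
  shows "skew_det n N (part lam) (part mu) = 0"
proof -
  obtain i where i: "part lam i < part mu i" using assms(3) by (auto simp: part_subset_def not_le)
  have iN: "i < N" using i assms(4) by (auto simp: part_def split: if_splits)
  have "(\<Prod>k<N. mult_ind n (int (part lam k) - int k - int (part mu (p k)) + int (p k))) = 0"
    if p: "p permutes {..<N}" for p
  proof -
    obtain k where k: "i \<le> k" "k < N" "p k \<le> i" using permutes_exists_le[OF p iN] .
    then have "part lam k < part mu (p k)"
      using i part_antimono[OF lam k(1)] part_antimono[OF mu k(3)] by linarith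
    then have "mult_ind n (int (part lam k) - int k - int (part mu (p k)) + int (p k)) = 0"
      using k by (simp add: mult_ind_def)
    with k(2) show ?thesis by (intro prod_zero) auto
  qed
  then show ?thesis unfolding skew_det_def det_mat_permutes
    by (intro sum.neutral ballI) (simp only: mem_Collect_eq mult_zero_right)
qed

text \<open>The case distinction matters: \<open>skew_matrix\<close> has size
  \<open>length lam\<close> and may cut off parts of \<open>mu\<close>; for \<open>lam = []\<close>
  its determinant is 1. The value 0 is the one that a large enough padding gives.\<close>

definition skew_coeff :: "nat \<Rightarrow> nat list \<Rightarrow> nat list \<Rightarrow> int" where
  "skew_coeff n lam mu = (if part_subset mu lam then det (skew_matrix n lam mu) else 0)"

lemma skew_det_eq_skew_coeff:
  assumes "is_partition lam" "is_partition mu" "length lam \<le> N" "length mu \<le> N"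
  shows "skew_det n N (part lam) (part mu) = skew_coeff n lam mu"
  using skew_det_skew_matrix skew_det_not_subset assms by (simp add: skew_coeff_def)

text \<open>The padding disappears: \<open>mu\<close>, \<open>nu\<close> and the partitions
  \<open>rho\<close> fit into \<open>L\<close> rows, and those above \<open>nu\<close> need at most
  one row more.\<close>

lemma skew_coeff_exchange:
  assumes mu: "is_partition mu" and nu: "is_partition nu"
  shows "(\<Sum>lam | is_partition lam \<and> horizontal_strip lam nu \<and> sum_list lam = sum_list nu + m.
      skew_coeff n lam mu)
    = (\<Sum>s | s \<le> m \<and> n dvd s.
        \<Sum>rho | is_partition rho \<and> horizontal_strip mu rho \<and> sum_list mu = sum_list rho + (m - s).
          skew_coeff n nu rho)"
proof -
  define L where "L = max (length mu) (length nu)"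
  have up: "length lam \<le> Suc L" if "is_partition lam" "horizontal_strip lam nu" for lam
  proof -
    have "part lam (Suc L) \<le> part nu L" using that by (simp add: horizontal_strip_def)
    also have "part nu L = 0" by (simp add: part_def L_def)
    finally show ?thesis using part_eq_0_iff that by simp
  qed
  have down: "length rho \<le> L" if "is_partition rho" "horizontal_strip mu rho" for rho
  proof -
    have "part rho L \<le> part mu L" using that by (simp add: horizontal_strip_def)
    also have "part mu L = 0" by (simp add: part_def L_def)
    finally show ?thesis using part_eq_0_iff that by simp
  qed
  have "(\<Sum>lam | is_partition lam \<and> horizontal_strip lam nu \<and> sum_list lam = sum_list nu + m.
      skew_coeff n lam mu)
    = (\<Sum>lam | is_partition lam \<and> horizontal_strip lam nu \<and> sum_list lam = sum_list nu + m.
      skew_det n (Suc L) (part lam) (part mu))"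
    using mu up by (intro sum.cong refl skew_det_eq_skew_coeff[symmetric]) (auto simp: L_def)
  also have "\<dots> = (\<Sum>s | s \<le> m \<and> n dvd s.
        \<Sum>rho | is_partition rho \<and> horizontal_strip mu rho \<and> sum_list mu = sum_list rho + (m - s).
          skew_det n L (part nu) (part rho))"
    by (rule horizontal_strip_exchange[OF mu nu]) (auto simp: L_def)
  also have "\<dots> = (\<Sum>s | s \<le> m \<and> n dvd s.
        \<Sum>rho | is_partition rho \<and> horizontal_strip mu rho \<and> sum_list mu = sum_list rho + (m - s).
          skew_coeff n nu rho)"
    using nu down by (intro sum.cong refl skew_det_eq_skew_coeff) (auto simp: L_def)
  finally show ?thesis .
qed

text \<open>Split \<open>A\<close> by its multiplicity \<open>s\<close> at \<open>r\<close>; the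
  rest of \<open>A\<close> lies in \<open>M\<close>, which is free of \<open>r\<close>, and varies
  independently of \<open>s\<close>.\<close>

lemma sum_submultisets_add_replicate:
  fixes M :: "nat multiset"
  assumes "r \<notin># M"
  shows "(\<Sum>A | A \<subseteq># M + replicate_mset m r \<and> (\<forall>x. n dvd count A x). f (M + replicate_mset m r - A))
    = (\<Sum>s | s \<le> m \<and> n dvd s. \<Sum>A | A \<subseteq># M \<and> (\<forall>x. n dvd count A x). f (M - A + replicate_mset (m - s) r))"
proof -
  have r0: "count M r = 0" using assms by (simp add: not_in_iff)
  have "(\<Sum>A | A \<subseteq># M + replicate_mset m r \<and> (\<forall>x. n dvd count A x). f (M + replicate_mset m r - A))
    = (\<Sum>(s, A) \<in> {s. s \<le> m \<and> n dvd s} \<times> {A. A \<subseteq># M \<and> (\<forall>x. n dvd count A x)}.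
        f (M - A + replicate_mset (m - s) r))"
  proof (rule sum.reindex_bij_witness[of _ "\<lambda>(s, A). A + replicate_mset s r"
        "\<lambda>A. (count A r, filter_mset (\<lambda>x. x \<noteq> r) A)"], goal_cases)
    case (1 A)
    then show ?case by (auto simp: multiset_eq_iff)
  next
    case (2 A)
    then show ?case using r0
      by (auto simp: subseteq_mset_def dest: spec[of _ r]) (metis add.right_neutral)
  next
    case (3 p)
    obtain s A where p: "p = (s, A)" by (cases p)
    have "count A r = 0" using 3 r0 by (auto simp: p subseteq_mset_def) (metis le_zero_eq)
    then show ?case by (auto simp: p multiset_eq_iff)
  next
    case (4 p)
    then show ?case by (auto simp: subseteq_mset_def add_mono)
  next
    case (5 A)
    then have "count A x \<le> count M x + (if x = r then m else 0)" for x by (auto simp: subseteq_mset_def)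
    then have "M + replicate_mset m r - A
      = M - filter_mset (\<lambda>x. x \<noteq> r) A + replicate_mset (m - count A r) r"
      using r0 by (auto simp: multiset_eq_iff)
    then show ?case by simp
  qed
  then show ?thesis by (simp only: sum.cartesian_product)
qed

section \<open>Induction on the number of variables\<close>

lemma empty_ssyt_number: "ssyt_number lam {#} = (if lam = [] then 1 else 0)" if lam: "is_partition lam"
proof (cases "lam = []")
  case True
  have "{T \<in> ssyt []. tableau_content [] T = {#}} = {\<lambda>_. undefined}"
    by (auto simp: ssyt_def tableau_content_def young_diagram_def part_def)
  then show ?thesis using True by (simp add: ssyt_number_def)
next
  case False
  then have "sum_list lam \<noteq> 0" using lam by (cases lam) (auto simp: is_partition_def)
  then show ?thesis using False ssyt_number_nonzero_size[of lam "{#}"] by (metis size_empty)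
qed

text \<open>The coefficient of the monomial \<open>M\<close> in the skew Cauchy identity: for
  \<open>n > 0\<close>, a multiset with all multiplicities divisible by \<open>n\<close> is a
  monomial of the product of the series \<open>1 / (1 - x_i^n)\<close>. The induction needs all
  \<open>mu\<close>, since removing a variable replaces \<open>mu\<close> by partitions inside
  it.\<close>

lemma sum_skew_coeff_ssyt_number:
  assumes "is_partition mu" "set_mset M \<subseteq> {..<r}"
  shows "(\<Sum>lam | is_partition lam \<and> sum_list lam = size M. skew_coeff n lam mu * int (ssyt_number lam M))
    = (\<Sum>A | A \<subseteq># M \<and> (\<forall>x. n dvd count A x). int (ssyt_number mu (M - A)))"
  using assms
proof (induction r arbitrary: mu M)
  case 0
  then have M: "M = {#}" by simp
  have "{lam. is_partition lam \<and> sum_list lam = 0} = {[]}"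
    by (auto simp: is_partition_def) (metis list.set_intros(1) neq_Nil_conv)
  moreover have "{A. A \<subseteq># {#} \<and> (\<forall>x. n dvd count A x)} = {{#} :: nat multiset}" by auto
  moreover have "skew_coeff n [] mu = (if mu = [] then 1 else 0)"
    using part_eq_0_iff[OF "0.prems"(1), of 0]
    by (auto simp: skew_coeff_def part_subset_def part_def skew_matrix_def)
  moreover have "is_partition []" by (simp add: is_partition_def)
  ultimately show ?case using "0.prems" by (simp add: M empty_ssyt_number)
next
  case (Suc r)
  define m where "m = count M r"
  define M' where "M' = filter_mset (\<lambda>x. x \<noteq> r) M"
  have M: "M = M' + replicate_mset m r" by (auto simp: M'_def m_def multiset_eq_iff)
  have M': "set_mset M' \<subseteq> {..<r}" "r \<notin># M'" using Suc.prems(2) by (auto simp: M'_def less_Suc_eq)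
  define P where "P N = {lam. is_partition lam \<and> sum_list lam = N}" for N
  define H where "H k = {rho. is_partition rho \<and> horizontal_strip mu rho \<and> sum_list mu = sum_list rho + k}" for k
  have finP: "finite (P N)" for N unfolding P_def by (rule finite_partitions)
  have "(\<Sum>lam\<in>P (size M). skew_coeff n lam mu * int (ssyt_number lam M))
    = (\<Sum>lam\<in>P (size M' + m). \<Sum>nu | nu \<in> P (size M') \<and> horizontal_strip lam nu.
        skew_coeff n lam mu * int (ssyt_number nu M'))"
  proof (rule sum.cong)
    show "P (size M) = P (size M' + m)" by (simp add: M)
  next
    fix lam assume lam: "lam \<in> P (size M' + m)"
    have "ssyt_number lam M
      = (\<Sum>nu | is_partition nu \<and> horizontal_strip lam nu \<and> sum_list lam = sum_list nu + m. ssyt_number nu M')"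
      unfolding M by (rule ssyt_number_add_replicate) (use lam M' in \<open>auto simp: P_def\<close>)
    also have "{nu. is_partition nu \<and> horizontal_strip lam nu \<and> sum_list lam = sum_list nu + m}
      = {nu. nu \<in> P (size M') \<and> horizontal_strip lam nu}" using lam by (auto simp: P_def)
    finally show "skew_coeff n lam mu * int (ssyt_number lam M)
      = (\<Sum>nu | nu \<in> P (size M') \<and> horizontal_strip lam nu. skew_coeff n lam mu * int (ssyt_number nu M'))"
      by (simp add: sum_distrib_left)
  qed
  also have "\<dots> = (\<Sum>nu\<in>P (size M'). \<Sum>lam | lam \<in> P (size M' + m) \<and> horizontal_strip lam nu.
      skew_coeff n lam mu * int (ssyt_number nu M'))"
    by (rule sum.swap_restrict) (rule finP)+
  \<comment> \<open>The commutation relation: the strip removed from \<open>lam\<close> becomes a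
    strip removed from \<open>mu\<close>, up to \<open>s\<close> boxes absorbed by the factor
    \<open>1 / (1 - x^n)\<close>.\<close>
  also have "\<dots> = (\<Sum>nu\<in>P (size M'). \<Sum>s | s \<le> m \<and> n dvd s. \<Sum>rho\<in>H (m - s).
      skew_coeff n nu rho * int (ssyt_number nu M'))"
  proof (rule sum.cong[OF refl])
    fix nu assume nu: "nu \<in> P (size M')"
    then have "{lam. lam \<in> P (size M' + m) \<and> horizontal_strip lam nu}
      = {lam. is_partition lam \<and> horizontal_strip lam nu \<and> sum_list lam = sum_list nu + m}"
      by (auto simp: P_def)
    moreover have "is_partition nu" using nu by (simp add: P_def)
    ultimately show "(\<Sum>lam | lam \<in> P (size M' + m) \<and> horizontal_strip lam nu.
        skew_coeff n lam mu * int (ssyt_number nu M'))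
      = (\<Sum>s | s \<le> m \<and> n dvd s. \<Sum>rho\<in>H (m - s). skew_coeff n nu rho * int (ssyt_number nu M'))"
      using skew_coeff_exchange[OF Suc.prems(1), where nu = nu and m = m and n = n]
      by (simp add: H_def flip: sum_distrib_right)
  qed
  also have "\<dots> = (\<Sum>s | s \<le> m \<and> n dvd s. \<Sum>rho\<in>H (m - s). \<Sum>nu\<in>P (size M').
      skew_coeff n nu rho * int (ssyt_number nu M'))"
    by (subst sum.swap, rule sum.cong[OF refl], rule sum.swap)
  also have "\<dots> = (\<Sum>s | s \<le> m \<and> n dvd s. \<Sum>rho\<in>H (m - s).
      \<Sum>A | A \<subseteq># M' \<and> (\<forall>x. n dvd count A x). int (ssyt_number rho (M' - A)))"
    using Suc.IH[OF _ M'(1)] by (intro sum.cong refl) (simp add: H_def P_def)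
  also have "\<dots> = (\<Sum>s | s \<le> m \<and> n dvd s. \<Sum>A | A \<subseteq># M' \<and> (\<forall>x. n dvd count A x).
      \<Sum>rho\<in>H (m - s). int (ssyt_number rho (M' - A)))"
    by (rule sum.cong[OF refl], rule sum.swap)
  \<comment> \<open>Strip removal read backwards: the sum over \<open>rho\<close> restores the
    tableaux of shape \<open>mu\<close> with \<open>m - s\<close> entries \<open>r\<close>.\<close>
  also have "\<dots> = (\<Sum>s | s \<le> m \<and> n dvd s. \<Sum>A | A \<subseteq># M' \<and> (\<forall>x. n dvd count A x).
      int (ssyt_number mu (M' - A + replicate_mset (m - s) r)))"
  proof (intro sum.cong refl)
    fix s A
    have "set_mset (M' - A) \<subseteq> {..<r}" using M'(1) in_diffD by fastforce
    then show "(\<Sum>rho\<in>H (m - s). int (ssyt_number rho (M' - A)))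
        = int (ssyt_number mu (M' - A + replicate_mset (m - s) r))"
      using Suc.prems(1) by (simp add: ssyt_number_add_replicate H_def)
  qed
  also have "\<dots> = (\<Sum>A | A \<subseteq># M \<and> (\<forall>x. n dvd count A x). int (ssyt_number mu (M - A)))"
    unfolding M by (rule sum_submultisets_add_replicate[OF M'(2), symmetric])
  finally show ?case by (simp only: P_def)
qed


section \<open>Coefficients of symmetric functions\<close>

lemma symfun_coeff_sum: "symfun_coeff (\<Sum>x\<in>S. f x) M = (\<Sum>x\<in>S. symfun_coeff (f x) M)"
  by (induction S rule: infinite_finite_induct) (simp_all add: zero_symfun.rep_eq plus_symfun.rep_eq)

lemma symfun_coeff_of_int_mult: "symfun_coeff (of_int z * f) M = of_int z * symfun_coeff f M"
proof -
  have *: "symfun_coeff (of_nat k * f) M = of_nat k * symfun_coeff f M" for k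
    by (induction k) (simp_all add: zero_symfun.rep_eq plus_symfun.rep_eq distrib_right)
  show ?thesis
    by (cases z rule: int_cases2) (simp_all add: * uminus_symfun.rep_eq)
qed

lemma symfun_coeff_schur: "is_partition lam \<Longrightarrow> symfun_coeff (schur lam) M = of_nat (ssyt_number lam M)"
  by (simp add: schur.rep_eq ssyt_number_def)

text \<open>A monomial \<open>A\<close> arises from at most one \<open>N\<close>, whose
  multiplicities are those of \<open>A\<close> divided by \<open>n\<close>.\<close>

lemma symfun_coeff_plethysm_complete_hom:
  assumes "n > 0"
  shows "symfun_coeff (power_sum_plethysm n (complete_hom k)) A
    = (if (\<forall>x. n dvd count A x) \<and> size A = n * k then 1 else 0)"
proof (cases "\<forall>x. n dvd count A x")
  case True
  have "finite {x. 0 < count A x div n}"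
    by (rule finite_subset[of _ "set_mset A"]) (auto simp: not_in_iff intro: ccontr)
  then have N: "count (Abs_multiset (\<lambda>x. count A x div n)) x = count A x div n" for x
    by (simp add: Abs_multiset_inverse)
  have "{N. repeat_mset n N = A} = {Abs_multiset (\<lambda>x. count A x div n)}"
    using True assms by (auto simp: multiset_eq_iff N) (metis nonzero_mult_div_cancel_left neq0_conv)
  moreover from this have "A = repeat_mset n (Abs_multiset (\<lambda>x. count A x div n))" by (metis mem_Collect_eq singletonI)
  then have "size A = n * size (Abs_multiset (\<lambda>x. count A x div n))" by (metis size_repeat_mset)
  ultimately show ?thesis using True assms by (simp add: power_sum_plethysm.rep_eq complete_hom.rep_eq)
next
  case False
  then have "{N. repeat_mset n N = A} = {}" by auto
  with False show ?thesis by (simp add: power_sum_plethysm.rep_eq)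
qed

theorem theorem3p4:
  fixes n k :: nat and mu :: "nat list"
  assumes "n > 0" and "k > 0" and "is_partition mu"
  shows "power_sum_plethysm n (complete_hom k) * schur mu =
    (\<Sum>lam | is_partition lam \<and> sum_list lam = sum_list mu + n * k \<and> part_subset mu lam.
       of_int (det (skew_matrix n lam mu)) * schur lam)"
proof (rule symfun_eqI)
  fix M :: "nat multiset"
  let ?N = "sum_list mu + n * k"
  let ?P = "{lam. is_partition lam \<and> sum_list lam = ?N}"
  let ?A = "{A. A \<subseteq># M \<and> (\<forall>x. n dvd count A x)}"
  have "symfun_coeff (power_sum_plethysm n (complete_hom k) * schur mu) M
    = (\<Sum>(A, B) | A + B = M. if (\<forall>x. n dvd count A x) \<and> size A = n * k then of_nat (ssyt_number mu B) else 0)"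
    unfolding times_symfun.rep_eq
    by (intro sum.cong refl)
      (auto simp: symfun_coeff_plethysm_complete_hom[OF assms(1)] symfun_coeff_schur[OF assms(3)])
  also have "\<dots> = (\<Sum>A | A \<subseteq># M.
      if (\<forall>x. n dvd count A x) \<and> size A = n * k then of_nat (ssyt_number mu (M - A)) else 0)"
    by (rule sum.reindex_bij_witness[of _ "\<lambda>A. (A, M - A)" fst]) auto
  \<comment> \<open>Nonzero terms have \<open>size (M - A) = sum_list mu\<close>, so the condition
    on \<open>size A\<close> becomes one on \<open>size M\<close> alone; this singles out
    \<open>k\<close> in an identity that covers all degrees.\<close>
  also have "\<dots> = (\<Sum>A | A \<subseteq># M. if \<forall>x. n dvd count A x
      then if size M = ?N then of_nat (ssyt_number mu (M - A)) else 0 else 0)"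
  proof (intro sum.cong refl)
    fix A assume "A \<in> {A. A \<subseteq># M}"
    then have "size M = size A + size (M - A)" by (simp add: size_Diff_submset size_mset_mono)
    moreover have "size (M - A) = sum_list mu" if "ssyt_number mu (M - A) \<noteq> 0"
      using ssyt_number_nonzero_size[OF that] .
    ultimately show "(if (\<forall>x. n dvd count A x) \<and> size A = n * k then of_nat (ssyt_number mu (M - A)) else 0)
      = (if \<forall>x. n dvd count A x then if size M = ?N then of_nat (ssyt_number mu (M - A)) else 0 else 0 :: rat)"
      by (cases "ssyt_number mu (M - A) = 0") auto
  qed
  also have "\<dots> = (\<Sum>A\<in>?A. if size M = ?N then of_nat (ssyt_number mu (M - A)) else 0)"
    by (subst sum.inter_filter[symmetric]) (auto simp: finite_submultisets intro: sum.cong)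
  also have "\<dots> = (if size M = ?N then of_int (\<Sum>A\<in>?A. int (ssyt_number mu (M - A))) else 0)"
    by simp
  also have "\<dots> = (if size M = ?N then of_int (\<Sum>lam\<in>?P. skew_coeff n lam mu * int (ssyt_number lam M)) else 0)"
  proof -
    \<comment> \<open>Only finitely many variables occur in \<open>M\<close>, so the identity for
      boundedly many variables applies.\<close>
    obtain r where "set_mset M \<subseteq> {..<r}" by (metis finite_nat_iff_bounded finite_set_mset)
    from sum_skew_coeff_ssyt_number[OF assms(3) this, of n] show ?thesis
      by (intro if_cong[OF refl _ refl] arg_cong[where f = of_int]) simp
  qed
  \<comment> \<open>In any other degree no tableau of these shapes has content \<open>M\<close>, so
    the sum is 0 anyway.\<close>
  also have "\<dots> = of_int (\<Sum>lam\<in>?P. skew_coeff n lam mu * int (ssyt_number lam M))"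
    using ssyt_number_nonzero_size[of _ M] by (auto intro!: sum.neutral)
  also have "\<dots> = of_int (\<Sum>lam | is_partition lam \<and> sum_list lam = ?N \<and> part_subset mu lam.
      skew_coeff n lam mu * int (ssyt_number lam M))"
    by (rule arg_cong[where f = of_int], rule sum.mono_neutral_right)
      (auto simp: finite_partitions skew_coeff_def)
  also have "\<dots> = symfun_coeff (\<Sum>lam | is_partition lam \<and> sum_list lam = ?N \<and> part_subset mu lam.
       of_int (det (skew_matrix n lam mu)) * schur lam) M"
    unfolding symfun_coeff_sum of_int_sum
    by (intro sum.cong refl) (auto simp: symfun_coeff_of_int_mult symfun_coeff_schur skew_coeff_def)
  finally show "symfun_coeff (power_sum_plethysm n (complete_hom k) * schur mu) M
    = symfun_coeff (\<Sum>lam | is_partition lam \<and> sum_list lam = ?N \<and> part_subset mu lam.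
       of_int (det (skew_matrix n lam mu)) * schur lam) M" .
qed

end
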